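(* $$\widetilde H_M=\sum_{k\in\Lambda,\,\sigma=\uparrow,\downarrow}\sqrt{\xi_k^2+\widetilde\Delta_k^2}\;\widetilde\gamma_{k\sigma}^*\widetilde\gamma_{k\sigma}+\sum_{k\in\Lambda}\left\{\xi_k-\sqrt{\xi_k^2+\widetilde\Delta_k^2}+\widetilde\Delta_k\left(\widetilde\Psi,C_{-k\downarrow}C_{k\uparrow}\widetilde\Psi\right)\right\}.$$
   Context: Fix (large) real numbers $L,K_{max}>0$ and let $\Lambda=\{\frac{2\pi}{L}(n_1,n_2,n_3)\in\mathbb{R}^3: n_1,n_2,n_3\in\mathbb{Z},\ \frac{2\pi}{L}\sqrt{n_1^2+n_2^2+n_3^2}\le K_{max}\}$, a finite set with $M$ elements, whose elements are arranged in a fixed order. Let $\mathcal{H}=\mathbb{C}^{2^{2M}}$ with its standard inner product $(\cdot,\cdot)$; its standard unit vectors are labelled $|n_{k\uparrow},n_{k\downarrow},n_{k'\uparrow},n_{k'\downarrow},\ldots\rangle$ with $n_{k\sigma}\in\{0,1\}$, $k\in\Lambda$, $\sigma\in\{\uparrow,\downarrow\}$, and $|0\rangle$ denotes the one with all $n_{k\sigma}=0$. The annihilation operator $C_{k\sigma}$ is the linear operator on $\mathcal{H}$ which sends a standard unit vector with $n_{k\sigma}=1$ to $(-1)^{s}$ times the standard unit vector obtained by replacing $n_{k\sigma}$ by $0$, where $s$ is the sum of the occupation numbers to the left of $n_{k\sigma}$, and sends a standard unit vector with $n_{k\sigma}=0$ to $0$. The creation operator $C_{k\sigma}^*$ sends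 a standard unit vector with $n_{k\sigma}=0$ to $(-1)^{s}$ times the one with $n_{k\sigma}$ replaced by $1$ (same $s$), and one with $n_{k\sigma}=1$ to $0$; it is the adjoint of $C_{k\sigma}$. Let $m,\mu,\hbar>0$ and $\xi_k=\hbar^2|k|^2/(2m)-\mu$. Let $U_{k,k'}$ ($k,k'\in\Lambda$) be real with $U_{k,k'}\le 0$, $U_{k',k}=U_{k,k'}$, $U_{-k,-k'}=U_{k,k'}$, $U_{k,k}=0$. It is assumed that there is a function $\widetilde\Delta_k\ge0$ of $k\in\Lambda$ with $\widetilde\Delta_{-k}=\widetilde\Delta_k$ and $\widetilde E_k:=\sqrt{\xi_k^2+\widetilde\Delta_k^2}>0$ for all $k$, solving the new gap equation $$\widetilde\Delta_k=-\frac12\sum_{k'\in\Lambda}U_{k,k'}\frac{\widetilde\Delta_{k'}}{\widetilde E_{k'}}\left(1-\frac{4D_{k'}}{D+2}\right),\quad D_{k'}=\frac14\sum_{p\in\Lambda}\frac{U_{k',p}^2}{(\widetilde E_{k'}+\widetilde E_p)^2}\left(1-\frac{\xi_{k'}\xi_p}{\widetilde E_{k'}\widetilde E_p}\right)^2,\quad D=\sum_{k'\in\Lambda}D_{k'};$$ fix such a $\widetilde\Delta$. Let $\widetilde\theta_k\in[0,\pi/2]$ satisfy $\sin2\widetilde\theta_k=\widetilde\Delta_k/\widetilde E_k$, $\cos2\widetilde\theta_k=\xi_k/\widetilde E_k$. Let $\widetilde G_B=i\sum_{k\in\Lambda}\widetilde\theta_k(C_{-k\downarrow}C_{k\uparrow}-C_{k\uparrow}^*C_{-k\downarrow}^*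 )$, $\widetilde\Psi_{BCS}=e^{i\widetilde G_B}|0\rangle$, $\widetilde\gamma_{k\sigma}=e^{i\widetilde G_B}C_{k\sigma}e^{-i\widetilde G_B}$ (adjoint $\widetilde\gamma_{k\sigma}^*$), and write $\widetilde S_k=\sin\widetilde\theta_k$, $\widetilde C_k=\cos\widetilde\theta_k$. Put $$\widetilde\Phi=\frac12\sum_{p,p'\in\Lambda}\frac{U_{p,p'}(\widetilde C_p^2\widetilde S_{p'}^2+\widetilde C_{p'}^2\widetilde S_p^2)}{\widetilde E_p+\widetilde E_{p'}}\widetilde\gamma_{p\uparrow}^*\widetilde\gamma_{-p\downarrow}^*\widetilde\gamma_{p'\uparrow}^*\widetilde\gamma_{-p'\downarrow}^*\widetilde\Psi_{BCS},\qquad\widetilde\Psi=\frac{\widetilde\Psi_{BCS}+\widetilde\Phi}{\sqrt{1+(\widetilde\Phi,\widetilde\Phi)}}.$$ The mean field Hamiltonian is $$\widetilde H_M=\sum_{k\in\Lambda,\,\sigma=\uparrow,\downarrow}\xi_kC_{k\sigma}^*C_{k\sigma}-\sum_{k\in\Lambda}\widetilde\Delta_k\left(C_{-k\downarrow}C_{k\uparrow}+C_{k\uparrow}^*C_{-k\downarrow}^*\right)+\sum_{k\in\Lambda}\widetilde\Delta_k\left(\widetilde\Psi,C_{-k\downarrow}C_{k\uparrow}\widetilde\Psi\right).$$ Scalars are identified with multiples of the identity operator. *)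

theory Defs
  imports
    "HOL-Analysis.Analysis"
    "Jordan_Normal_Form.Schur_Decomposition"
begin

hide_const (open) Finite_Cartesian_Product.mat Finite_Cartesian_Product.vec

definition momenta :: "real \<Rightarrow> real \<Rightarrow> (real^3) set" where
  "momenta L Kmax =
     {(2 * pi / L) *\<^sub>R vector [of_int n1, of_int n2, of_int n3] | n1 n2 n3 :: int.
        2 * pi / L * sqrt ((of_int n1)\<^sup>2 + (of_int n2)\<^sup>2 + (of_int n3)\<^sup>2) \<le> Kmax}"

datatype spin = Up | Down

text \<open>
  The list \<open>ks\<close> enumerates the momenta in their fixed order (it is distinct, of length \<open>M\<close>).
  The Fock space is \<open>carrier_vec (fock_dim ks)\<close>. Its standard unit vectors
  \<open>unit_vec (fock_dim ks) i\<close>, \<open>i < 2 ^ (2 * M)\<close>, are labelled by occupation numbers as follows: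
  the modes are listed from left to right as \<open>k\<up>, k\<down>, k'\<up>, k'\<down>, \<dots>\<close>, and the mode at
  position \<open>j\<close> (counted from 0) is occupied in the \<open>i\<close>-th unit vector iff \<open>bit i j\<close>.
  In particular \<open>i = 0\<close> is the vector with all occupation numbers zero.
\<close>

definition fock_dim :: "(real^3) list \<Rightarrow> nat" where
  "fock_dim ks = 2 ^ (2 * length ks)"

abbreviation Op :: "(real^3) list \<Rightarrow> (complex, complex mat) module" where
  "Op ks \<equiv> module_mat TYPE(complex) (fock_dim ks) (fock_dim ks)"

abbreviation Fock :: "(real^3) list \<Rightarrow> (complex, complex vec) module" where
  "Fock ks \<equiv> module_vec TYPE(complex) (fock_dim ks)"

definition mode_pos :: "(real^3) list \<Rightarrow> real^3 \<Rightarrow> spin \<Rightarrow> nat" where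
  "mode_pos ks k \<sigma> =
     2 * (THE j. j < length ks \<and> ks ! j = k) + (case \<sigma> of Up \<Rightarrow> 0 | Down \<Rightarrow> 1)"

text \<open>The sum of the occupation numbers to the left of position \<open>p\<close> in the \<open>i\<close>-th unit vector.\<close>

definition occ_left :: "nat \<Rightarrow> nat \<Rightarrow> nat" where
  "occ_left i p = (\<Sum>j<p. of_bool (bit i j))"

definition vacuum :: "(real^3) list \<Rightarrow> complex vec" where
  "vacuum ks = unit_vec (fock_dim ks) 0"

text \<open>In both matrices the column index \<open>c\<close> is the unit vector acted upon.\<close>

definition annih :: "(real^3) list \<Rightarrow> real^3 \<Rightarrow> spin \<Rightarrow> complex mat" where
  "annih ks k \<sigma> = (let p = mode_pos ks k \<sigma> in
     mat (fock_dim ks) (fock_dim ks)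
       (\<lambda>(r, c). if bit c p \<and> r = unset_bit p c then (-1) ^ occ_left c p else 0))"

definition creat :: "(real^3) list \<Rightarrow> real^3 \<Rightarrow> spin \<Rightarrow> complex mat" where
  "creat ks k \<sigma> = (let p = mode_pos ks k \<sigma> in
     mat (fock_dim ks) (fock_dim ks)
       (\<lambda>(r, c). if \<not> bit c p \<and> r = Bit_Operations.set_bit p c then (-1) ^ occ_left c p else 0))"

lemma creat_eq_adjoint_annih: "creat ks k \<sigma> = mat_adjoint (annih ks k \<sigma>)"
proof -
  define p where "p = mode_pos ks k \<sigma>"
  define d where "d = fock_dim ks"
  have flip: "(\<not> bit c p \<and> r = Bit_Operations.set_bit p c) \<longleftrightarrow> (bit r p \<and> c = unset_bit p r)" for r c :: nat
    by (auto intro!: bit_eqI simp: bit_simps)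
  have sgn: "occ_left (unset_bit p r) p = occ_left r p" for r :: nat
    unfolding occ_left_def by (rule sum.cong) (auto simp: bit_simps)
  have dims: "dim_row (annih ks k \<sigma>) = d" "dim_col (annih ks k \<sigma>) = d"
    by (simp_all add: annih_def Let_def d_def)
  show ?thesis
  proof (rule eq_matI)
    fix r c assume "r < dim_row (mat_adjoint (annih ks k \<sigma>))" "c < dim_col (mat_adjoint (annih ks k \<sigma>))"
    then have r: "r < d" and c: "c < d"
      using dims by (auto simp: mat_adjoint_def)
    have "mat_adjoint (annih ks k \<sigma>) $$ (r, c) = cnj (annih ks k \<sigma> $$ (c, r))"
      using r c dims by (simp add: mat_adjoint_def mat_of_rows_index)
    also have "\<dots> = (if bit r p \<and> c = unset_bit p r then (-1) ^ occ_left r p else 0)"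
      using r c by (simp add: annih_def Let_def d_def p_def)
    also have "\<dots> = (if \<not> bit c p \<and> r = Bit_Operations.set_bit p c then (-1) ^ occ_left c p else 0)"
      unfolding flip by (auto simp: sgn)
    also have "\<dots> = creat ks k \<sigma> $$ (r, c)"
      using r c by (simp add: creat_def Let_def d_def p_def)
    finally show "creat ks k \<sigma> $$ (r, c) = mat_adjoint (annih ks k \<sigma>) $$ (r, c)" ..
  qed (use dims in \<open>simp_all add: creat_def Let_def d_def mat_adjoint_def\<close>)
qed

text \<open>
  The inner product is linear in the second argument; \<open>\<bullet>c\<close> is linear in the first one.
\<close>

definition ip :: "complex vec \<Rightarrow> complex vec \<Rightarrow> complex" where
  "ip v w = w \<bullet>c v"

text \<open>
  The exponential series of a square matrix, taken entrywise. It converges absolutely, so the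
  convention that a divergent \<open>suminf\<close> is unspecified plays no role.
\<close>

definition mat_exp :: "complex mat \<Rightarrow> complex mat" where
  "mat_exp A = mat (dim_row A) (dim_row A) (\<lambda>(i, j). \<Sum>n. (A ^\<^sub>m n) $$ (i, j) / fact n)"

abbreviation pair_annih :: "(real^3) list \<Rightarrow> real^3 \<Rightarrow> complex mat" where
  "pair_annih ks k \<equiv> annih ks (- k) Down * annih ks k Up"

abbreviation pair_creat :: "(real^3) list \<Rightarrow> real^3 \<Rightarrow> complex mat" where
  "pair_creat ks k \<equiv> creat ks k Up * creat ks (- k) Down"

definition band_energy :: "real \<Rightarrow> real \<Rightarrow> real \<Rightarrow> real^3 \<Rightarrow> real" where
  "band_energy hbar m \<mu> k = hbar\<^sup>2 * (norm k)\<^sup>2 / (2 * m) - \<mu>"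

definition qp_energy :: "(real^3 \<Rightarrow> real) \<Rightarrow> (real^3 \<Rightarrow> real) \<Rightarrow> real^3 \<Rightarrow> real" where
  "qp_energy \<xi> \<Delta> k = sqrt ((\<xi> k)\<^sup>2 + (\<Delta> k)\<^sup>2)"

definition gap_D ::
  "(real^3) set \<Rightarrow> (real^3 \<Rightarrow> real) \<Rightarrow> (real^3 \<Rightarrow> real^3 \<Rightarrow> real) \<Rightarrow> (real^3 \<Rightarrow> real) \<Rightarrow> real^3 \<Rightarrow> real"
where
  "gap_D \<Lambda> \<xi> U \<Delta> k' = 1/4 * (\<Sum>p\<in>\<Lambda>.
     (U k' p)\<^sup>2 / (qp_energy \<xi> \<Delta> k' + qp_energy \<xi> \<Delta> p)\<^sup>2
       * (1 - \<xi> k' * \<xi> p / (qp_energy \<xi> \<Delta> k' * qp_energy \<xi> \<Delta> p))\<^sup>2)"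

definition gap_equation ::
  "(real^3) set \<Rightarrow> (real^3 \<Rightarrow> real) \<Rightarrow> (real^3 \<Rightarrow> real^3 \<Rightarrow> real) \<Rightarrow> (real^3 \<Rightarrow> real) \<Rightarrow> bool"
where
  "gap_equation \<Lambda> \<xi> U \<Delta> \<longleftrightarrow> (\<forall>k\<in>\<Lambda>.
     \<Delta> k = - 1/2 * (\<Sum>k'\<in>\<Lambda>. U k k' * (\<Delta> k' / qp_energy \<xi> \<Delta> k')
       * (1 - 4 * gap_D \<Lambda> \<xi> U \<Delta> k' / ((\<Sum>q\<in>\<Lambda>. gap_D \<Lambda> \<xi> U \<Delta> q) + 2))))"

definition G_B :: "(real^3) list \<Rightarrow> (real^3 \<Rightarrow> real) \<Rightarrow> complex mat" where
  "G_B ks \<theta> = \<i> \<cdot>\<^sub>m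
     (\<Oplus>\<^bsub>Op ks\<^esub>k\<in>set ks. of_real (\<theta> k) \<cdot>\<^sub>m (pair_annih ks k - pair_creat ks k))"

definition Psi_BCS :: "(real^3) list \<Rightarrow> (real^3 \<Rightarrow> real) \<Rightarrow> complex vec" where
  "Psi_BCS ks \<theta> = mat_exp (\<i> \<cdot>\<^sub>m G_B ks \<theta>) *\<^sub>v vacuum ks"

definition qp_annih :: "(real^3) list \<Rightarrow> (real^3 \<Rightarrow> real) \<Rightarrow> real^3 \<Rightarrow> spin \<Rightarrow> complex mat" where
  "qp_annih ks \<theta> k \<sigma> =
     mat_exp (\<i> \<cdot>\<^sub>m G_B ks \<theta>) * annih ks k \<sigma> * mat_exp ((- \<i>) \<cdot>\<^sub>m G_B ks \<theta>)"

abbreviation qp_creat :: "(real^3) list \<Rightarrow> (real^3 \<Rightarrow> real) \<Rightarrow> real^3 \<Rightarrow> spin \<Rightarrow> complex mat" where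
  "qp_creat ks \<theta> k \<sigma> \<equiv> mat_adjoint (qp_annih ks \<theta> k \<sigma>)"

definition Phi ::
  "(real^3) list \<Rightarrow> (real^3 \<Rightarrow> real) \<Rightarrow> (real^3 \<Rightarrow> real^3 \<Rightarrow> real) \<Rightarrow> (real^3 \<Rightarrow> real)
     \<Rightarrow> (real^3 \<Rightarrow> real) \<Rightarrow> complex vec"
where
  "Phi ks \<xi> U \<Delta> \<theta> = (1/2) \<cdot>\<^sub>v
     (\<Oplus>\<^bsub>Fock ks\<^esub>p\<in>set ks. \<Oplus>\<^bsub>Fock ks\<^esub>p'\<in>set ks.
        of_real (U p p' * ((cos (\<theta> p))\<^sup>2 * (sin (\<theta> p'))\<^sup>2 + (cos (\<theta> p'))\<^sup>2 * (sin (\<theta> p))\<^sup>2)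
                  / (qp_energy \<xi> \<Delta> p + qp_energy \<xi> \<Delta> p'))
        \<cdot>\<^sub>v ((qp_creat ks \<theta> p Up * qp_creat ks \<theta> (- p) Down
               * qp_creat ks \<theta> p' Up * qp_creat ks \<theta> (- p') Down) *\<^sub>v Psi_BCS ks \<theta>))"

text \<open>\<open>Re\<close> only converts the type: \<open>ip v v\<close> is a nonnegative real number.\<close>

definition Psi ::
  "(real^3) list \<Rightarrow> (real^3 \<Rightarrow> real) \<Rightarrow> (real^3 \<Rightarrow> real^3 \<Rightarrow> real) \<Rightarrow> (real^3 \<Rightarrow> real)
     \<Rightarrow> (real^3 \<Rightarrow> real) \<Rightarrow> complex vec"
where
  "Psi ks \<xi> U \<Delta> \<theta> =
     of_real (1 / sqrt (1 + Re (ip (Phi ks \<xi> U \<Delta> \<theta>) (Phi ks \<xi> U \<Delta> \<theta>))))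
       \<cdot>\<^sub>v (Psi_BCS ks \<theta> + Phi ks \<xi> U \<Delta> \<theta>)"

definition H_M ::
  "(real^3) list \<Rightarrow> (real^3 \<Rightarrow> real) \<Rightarrow> (real^3 \<Rightarrow> real^3 \<Rightarrow> real) \<Rightarrow> (real^3 \<Rightarrow> real)
     \<Rightarrow> (real^3 \<Rightarrow> real) \<Rightarrow> complex mat"
where
  "H_M ks \<xi> U \<Delta> \<theta> =
     (\<Oplus>\<^bsub>Op ks\<^esub>k\<in>set ks. \<Oplus>\<^bsub>Op ks\<^esub>\<sigma>\<in>{Up, Down}.
        of_real (\<xi> k) \<cdot>\<^sub>m (creat ks k \<sigma> * annih ks k \<sigma>))
     - (\<Oplus>\<^bsub>Op ks\<^esub>k\<in>set ks. of_real (\<Delta> k) \<cdot>\<^sub>m (pair_annih ks k + pair_creat ks k))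
     + (\<Sum>k\<in>set ks. of_real (\<Delta> k) * ip (Psi ks \<xi> U \<Delta> \<theta>) (pair_annih ks k *\<^sub>v Psi ks \<xi> U \<Delta> \<theta>))
         \<cdot>\<^sub>m 1\<^sub>m (fock_dim ks)"

end

theory Submission
  imports Defs
begin

text \<open>
  Put \<open>A = i G\<^sub>B\<close>, \<open>X = C\<^bsub>k\<up>\<^esub>\<close>, \<open>Y = C\<^sup>*\<^bsub>-k\<down>\<^esub>\<close>. The canonical anticommutation relations give
  \<open>[A, X] = - \<theta>\<^sub>k Y\<close> and \<open>[A, Y] = \<theta>\<^sub>k X\<close>, so \<open>X \<plusminus> i Y\<close> are eigenvectors of \<open>ad A\<close>, hence of
  conjugation by \<open>exp A\<close>, and \<open>\<gamma>\<^bsub>k\<up>\<^esub> = cos \<theta>\<^sub>k X - sin \<theta>\<^sub>k Y\<close>; likewise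
  \<open>\<gamma>\<^bsub>-k\<down>\<^esub> = cos \<theta>\<^sub>k C\<^bsub>-k\<down>\<^esub> + sin \<theta>\<^sub>k C\<^sup>*\<^bsub>k\<up>\<^esub>\<close>. Expanding the number operators of the modes \<open>k\<up>\<close> and
  \<open>-k\<down>\<close> and using \<open>E\<^sub>k cos 2\<theta>\<^sub>k = \<xi>\<^sub>k\<close>, \<open>E\<^sub>k sin 2\<theta>\<^sub>k = \<Delta>\<^sub>k\<close> turns their sum into the
  \<open>k\<close>-th term of the Hamiltonian up to the constant \<open>E\<^sub>k - \<xi>\<^sub>k\<close>.
\<close>

subsection \<open>The exponential of a complex matrix\<close>

text \<open>Two matrices \<open>A\<close> and \<open>B\<close> are allowed because
  \<open>mat_exp_eigen\<close> needs a \<open>Z\<close> that intertwines \<open>A\<close> with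
  \<open>c\<close> times the identity plus \<open>A\<close>. The case \<open>A\<close> =
  \<open>B\<close> is the commutation used in \<open>binomial_mat\<close>.\<close>

lemma pow_mat_comm:
  fixes A B :: "'a :: semiring_1 mat"
  assumes A: "A \<in> carrier_mat n n" and B: "B \<in> carrier_mat n n" and Z: "Z \<in> carrier_mat n n"
    and AZ: "A * Z = Z * B"
  shows "A ^\<^sub>m k * Z = Z * B ^\<^sub>m k"
proof (induction k)
  case 0
  then show ?case using A B Z by simp
next
  case (Suc k)
  have pA: "A ^\<^sub>m k \<in> carrier_mat n n" and pB: "B ^\<^sub>m k \<in> carrier_mat n n" using A B by simp_all
  have "A ^\<^sub>m Suc k * Z = A ^\<^sub>m k * (A * Z)" using pA A Z by (simp add: assoc_mult_mat[of _ n n _ n _ n])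
  also have "\<dots> = A ^\<^sub>m k * Z * B" using pA B Z by (simp add: AZ assoc_mult_mat[of _ n n _ n _ n])
  also have "\<dots> = Z * B ^\<^sub>m Suc k" using pB B Z by (simp add: Suc assoc_mult_mat[of _ n n _ n _ n])
  finally show ?case .
qed

text \<open>Pascal's rule under the summation sign. In \<open>binomial_mat\<close> the value
  \<open>f l\<close> is an entry of \<open>A ^\<^sub>m l * B ^\<^sub>m (Suc k - l)\<close>.\<close>

lemma sum_choose_Suc:
  fixes f :: "nat \<Rightarrow> 'a :: comm_semiring_1"
  shows "(\<Sum>l\<le>Suc k. of_nat (Suc k choose l) * f l)
       = (\<Sum>l\<le>k. of_nat (k choose l) * f (Suc l)) + (\<Sum>l\<le>k. of_nat (k choose l) * f l)"
proof -
  have "(\<Sum>l\<le>Suc k. of_nat (Suc k choose l) * f l)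
      = f 0 + (\<Sum>l\<le>k. of_nat (k choose l) * f (Suc l)) + (\<Sum>l\<le>k. of_nat (k choose Suc l) * f (Suc l))"
    by (subst sum.atMost_Suc_shift) (simp add: algebra_simps sum.distrib)
  also have "f 0 + (\<Sum>l\<le>k. of_nat (k choose l) * f (Suc l)) + (\<Sum>l\<le>k. of_nat (k choose Suc l) * f (Suc l))
     = (\<Sum>l\<le>k. of_nat (k choose l) * f (Suc l)) + (\<Sum>l\<le>Suc k. of_nat (k choose l) * f l)"
    by (simp only: sum.atMost_Suc_shift[of "\<lambda>l. of_nat (k choose l) * f l"]) (simp add: algebra_simps)
  \<comment> \<open>The index shift leaves an extra summand at \<open>l = Suc k\<close>, whose
    coefficient \<open>k choose Suc k\<close> is zero.\<close>
  finally show ?thesis by (simp add: binomial_eq_0)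
qed

lemma index_mult_mat_sum:
  assumes "A \<in> carrier_mat nr n" "B \<in> carrier_mat n nc" "i < nr" "j < nc"
  shows "(A * B) $$ (i, j) = (\<Sum>m<n. A $$ (i, m) * B $$ (m, j))"
  using assms by (auto simp: scalar_prod_def atLeast0LessThan)

text \<open>Induction by multiplying with \<open>A + B\<close> on the right; commutation carries
  \<open>A\<close> across the powers of \<open>B\<close>, and Pascal's rule collects the two sums.
  Working with entries turns the expansion into a sum of scalars, which is the form the Cauchy
  product in \<open>mat_exp_add\<close> meets.\<close>

lemma binomial_mat:
  fixes A B :: "'a :: comm_semiring_1 mat"
  assumes A: "A \<in> carrier_mat n n" and B: "B \<in> carrier_mat n n" and AB: "A * B = B * A"
  shows "i < n \<Longrightarrow> j < n \<Longrightarrow> ((A + B) ^\<^sub>m k) $$ (i, j)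
     = (\<Sum>l\<le>k. of_nat (k choose l) * (A ^\<^sub>m l * B ^\<^sub>m (k - l)) $$ (i, j))"
proof (induction k arbitrary: j)
  case 0
  then show ?case using A B by simp
next
  case (Suc k)
  have car: "A ^\<^sub>m l \<in> carrier_mat n n" "B ^\<^sub>m l \<in> carrier_mat n n" for l using A B by simp_all
  have step: "A ^\<^sub>m l * B ^\<^sub>m (k - l) * (A + B)
      = A ^\<^sub>m Suc l * B ^\<^sub>m (Suc k - Suc l) + A ^\<^sub>m l * B ^\<^sub>m (Suc k - l)" if "l \<le> k" for l
  proof -
    have "A ^\<^sub>m l * B ^\<^sub>m (k - l) * A = A ^\<^sub>m l * (A * B ^\<^sub>m (k - l))"
      using A B car pow_mat_comm[OF B B A AB[symmetric], of "k - l"] by (simp add: assoc_mult_mat[of _ n n _ n _ n])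
    also have "\<dots> = A ^\<^sub>m Suc l * B ^\<^sub>m (k - l)"
      using A car by (simp add: assoc_mult_mat[symmetric, of _ n n _ n _ n])
    finally show ?thesis
      using A B car[of l] car[of "k - l"] that mult_carrier_mat[OF car(2)[of "k - l"] A] mult_carrier_mat[OF car(2)[of "k - l"] B]
      by (simp add: mult_add_distrib_mat[of _ n n _ n] Suc_diff_le assoc_mult_mat[of _ n n _ n _ n])
  qed
  have "((A + B) ^\<^sub>m Suc k) $$ (i, j) = (\<Sum>m<n. ((A + B) ^\<^sub>m k) $$ (i, m) * (A + B) $$ (m, j))"
    using A B Suc.prems by (simp add: index_mult_mat_sum[of _ n n _ n] del: index_mult_mat(1))
  also have "\<dots> = (\<Sum>m<n. \<Sum>l\<le>k. of_nat (k choose l) * (A ^\<^sub>m l * B ^\<^sub>m (k - l)) $$ (i, m) * (A + B) $$ (m, j))"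
    using Suc by (simp add: sum_distrib_right del: index_add_mat)
  also have "\<dots> = (\<Sum>l\<le>k. of_nat (k choose l) * (\<Sum>m<n. (A ^\<^sub>m l * B ^\<^sub>m (k - l)) $$ (i, m) * (A + B) $$ (m, j)))"
    by (subst sum.swap) (simp add: sum_distrib_left mult.assoc del: index_add_mat index_mult_mat)
  also have "\<dots> = (\<Sum>l\<le>k. of_nat (k choose l) * (A ^\<^sub>m l * B ^\<^sub>m (k - l) * (A + B)) $$ (i, j))"
    using A B car Suc.prems
    by (intro sum.cong refl arg_cong2[where f = "(*)"] index_mult_mat_sum[symmetric]) auto
  also have "\<dots> = (\<Sum>l\<le>k. of_nat (k choose l) * (A ^\<^sub>m Suc l * B ^\<^sub>m (Suc k - Suc l)) $$ (i, j))
                + (\<Sum>l\<le>k. of_nat (k choose l) * (A ^\<^sub>m l * B ^\<^sub>m (Suc k - l)) $$ (i, j))"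
    unfolding sum.distrib[symmetric]
  proof (rule sum.cong[OF refl], goal_cases)
    case (1 l)
    have "A ^\<^sub>m Suc l * B ^\<^sub>m (Suc k - Suc l) \<in> carrier_mat n n" "A ^\<^sub>m l * B ^\<^sub>m (Suc k - l) \<in> carrier_mat n n"
      using A B by (metis mult_carrier_mat pow_carrier_mat)+
    then show ?case using 1 Suc.prems
      by (subst step) (simp_all add: algebra_simps del: index_mult_mat pow_mat.simps)
  qed
  also have "\<dots> = (\<Sum>l\<le>Suc k. of_nat (Suc k choose l) * (A ^\<^sub>m l * B ^\<^sub>m (Suc k - l)) $$ (i, j))"
    by (rule sum_choose_Suc[symmetric])
  finally show ?case .
qed

section \<open>Convergence and functional equation of the exponential\<close>

lemma mat_exp_carrier [simp]: "A \<in> carrier_mat n n \<Longrightarrow> mat_exp A \<in> carrier_mat n n"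
  by (simp add: mat_exp_def)

text \<open>With \<open>a\<close> the sum of the absolute values of all entries of \<open>A\<close>,
  induction on \<open>k\<close> bounds the entries of the \<open>k\<close>-th power by
  \<open>(real n * a) ^ k\<close>. The series is therefore dominated by the scalar exponential
  series at \<open>real n * a\<close>.\<close>

lemma summable_mat_exp:
  fixes A :: "complex mat"
  assumes A: "A \<in> carrier_mat n n" and ij: "i < n" "j < n"
  shows "summable (\<lambda>k. norm ((A ^\<^sub>m k) $$ (i, j) / fact k))"
proof -
  define a where "a = (\<Sum>i<n. \<Sum>j<n. norm (A $$ (i, j)))"
  have a: "norm (A $$ (i, j)) \<le> a" if "i < n" "j < n" for i j
  proof -
    have "norm (A $$ (i, j)) \<le> (\<Sum>j<n. norm (A $$ (i, j)))"
      using that by (intro member_le_sum) auto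
    also have "\<dots> \<le> a"
      unfolding a_def using that by (intro member_le_sum[where f = "\<lambda>i. \<Sum>j<n. norm (A $$ (i, j))"] sum_nonneg) auto
    finally show ?thesis .
  qed
  have a0: "0 \<le> a" unfolding a_def by (intro sum_nonneg) auto
  have bound: "j < n \<Longrightarrow> norm ((A ^\<^sub>m k) $$ (i, j)) \<le> (real n * a) ^ k" for k j
  proof (induction k arbitrary: j)
    case 0
    then show ?case using A ij by (simp add: one_mat_def)
  next
    case (Suc k)
    have "norm ((A ^\<^sub>m Suc k) $$ (i, j)) = norm (\<Sum>m<n. (A ^\<^sub>m k) $$ (i, m) * A $$ (m, j))"
      using A ij Suc.prems by (simp add: index_mult_mat_sum[of _ n n _ n] del: index_mult_mat(1))
    also have "\<dots> \<le> (\<Sum>m<n. (real n * a) ^ k * a)"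
      using Suc a a0 by (intro sum_norm_le) (auto simp: norm_mult intro!: mult_mono)
    also have "\<dots> = (real n * a) ^ Suc k" by simp
    finally show ?case .
  qed
  have "summable (\<lambda>k. (real n * a) ^ k / fact k)"
    using summable_exp_generic[of "real n * a"] by (simp add: divide_inverse mult.commute)
  then show ?thesis
    by (rule summable_comparison_test') (use bound ij in \<open>auto simp: norm_divide intro!: divide_right_mono\<close>)
qed

lemmas summable_mat_exp' = summable_norm_cancel[OF summable_mat_exp]

lemma index_mat_exp:
  "A \<in> carrier_mat n n \<Longrightarrow> i < n \<Longrightarrow> j < n \<Longrightarrow> mat_exp A $$ (i, j) = (\<Sum>k. (A ^\<^sub>m k) $$ (i, j) / fact k)"
  by (simp add: mat_exp_def)

text \<open>The relation holds for all powers by \<open>pow_mat_comm\<close>. An entry of a product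
  is a finite sum, so passing to the exponential only exchanges finite sums with convergent
  series.\<close>

lemma mat_exp_comm:
  assumes A: "A \<in> carrier_mat n n" and B: "B \<in> carrier_mat n n" and Z: "Z \<in> carrier_mat n n"
    and AZ: "A * Z = Z * B"
  shows "mat_exp A * Z = Z * mat_exp B"
proof (rule eq_matI)
  fix i j assume "i < dim_row (Z * mat_exp B)" "j < dim_col (Z * mat_exp B)"
  then have ij: "i < n" "j < n" using Z mat_exp_carrier[OF B] by auto
  have "(mat_exp A * Z) $$ (i, j) = (\<Sum>m<n. (\<Sum>k. (A ^\<^sub>m k) $$ (i, m) / fact k) * Z $$ (m, j))"
    using A Z ij by (simp add: index_mult_mat_sum[of _ n n _ n] index_mat_exp del: index_mult_mat(1))
  also have "\<dots> = (\<Sum>m<n. \<Sum>k. (A ^\<^sub>m k) $$ (i, m) / fact k * Z $$ (m, j))"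
    using A ij by (intro sum.cong refl suminf_mult2 summable_mat_exp') auto
  also have "\<dots> = (\<Sum>k. \<Sum>m<n. (A ^\<^sub>m k) $$ (i, m) / fact k * Z $$ (m, j))"
    using A ij by (intro suminf_sum[symmetric] summable_mult2 summable_mat_exp') auto
  also have "\<dots> = (\<Sum>k. (A ^\<^sub>m k * Z) $$ (i, j) / fact k)"
    using A Z ij by (simp add: index_mult_mat_sum[of _ n n _ n] sum_divide_distrib del: index_mult_mat(1))
  also have "\<dots> = (\<Sum>k. (Z * B ^\<^sub>m k) $$ (i, j) / fact k)"
    by (simp only: pow_mat_comm[OF A B Z AZ])
  also have "\<dots> = (\<Sum>k. \<Sum>m<n. Z $$ (i, m) * ((B ^\<^sub>m k) $$ (m, j) / fact k))"
    using B Z ij by (simp add: index_mult_mat_sum[of _ n n _ n] sum_divide_distrib del: index_mult_mat(1))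
  also have "\<dots> = (\<Sum>m<n. \<Sum>k. Z $$ (i, m) * ((B ^\<^sub>m k) $$ (m, j) / fact k))"
    using B ij by (intro suminf_sum summable_mult summable_mat_exp') auto
  also have "\<dots> = (\<Sum>m<n. Z $$ (i, m) * (\<Sum>k. (B ^\<^sub>m k) $$ (m, j) / fact k))"
    using B ij by (intro sum.cong refl suminf_mult summable_mat_exp') auto
  also have "\<dots> = (Z * mat_exp B) $$ (i, j)"
    using B Z ij by (simp add: index_mult_mat_sum[of _ n n _ n] index_mat_exp del: index_mult_mat(1))
  finally show "(mat_exp A * Z) $$ (i, j) = (Z * mat_exp B) $$ (i, j)" .
qed (use Z mat_exp_carrier[OF A] mat_exp_carrier[OF B] in auto)

text \<open>Absolute convergence allows the Cauchy product of the entry series. Its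
  \<open>k\<close>-th term is the binomial expansion of \<open>A + B\<close> to the power
  \<open>k\<close>, divided by \<open>fact k\<close>.\<close>

lemma mat_exp_add:
  assumes A: "A \<in> carrier_mat n n" and B: "B \<in> carrier_mat n n" and AB: "A * B = B * A"
  shows "mat_exp (A + B) = mat_exp A * mat_exp B"
proof (rule eq_matI)
  fix i j assume "i < dim_row (mat_exp A * mat_exp B)" "j < dim_col (mat_exp A * mat_exp B)"
  then have ij: "i < n" "j < n" using mat_exp_carrier[OF A] mat_exp_carrier[OF B] by auto
  let ?a = "\<lambda>m k. (A ^\<^sub>m k) $$ (i, m) / fact k" and ?b = "\<lambda>m k. (B ^\<^sub>m k) $$ (m, j) / fact k"
  have sa: "summable (\<lambda>k. norm (?a m k))" "summable (\<lambda>k. norm (?b m k))" if "m < n" for m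
    using summable_mat_exp A B ij that by blast+
  have "(mat_exp A * mat_exp B) $$ (i, j) = (\<Sum>m<n. (\<Sum>k. ?a m k) * (\<Sum>k. ?b m k))"
    using A B ij by (simp add: index_mult_mat_sum[of _ n n _ n] index_mat_exp del: index_mult_mat(1))
  also have "\<dots> = (\<Sum>m<n. \<Sum>k. \<Sum>l\<le>k. ?a m l * ?b m (k - l))"
    using sa by (intro sum.cong refl Cauchy_product) auto
  also have "\<dots> = (\<Sum>k. \<Sum>m<n. \<Sum>l\<le>k. ?a m l * ?b m (k - l))"
    using sa by (intro suminf_sum[symmetric] summable_Cauchy_product) auto
  also have "\<dots> = (\<Sum>k. ((A + B) ^\<^sub>m k) $$ (i, j) / fact k)"
  proof (rule suminf_cong)
    fix k
    have "(\<Sum>m<n. \<Sum>l\<le>k. ?a m l * ?b m (k - l))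
        = (\<Sum>l\<le>k. (A ^\<^sub>m l * B ^\<^sub>m (k - l)) $$ (i, j) / (fact l * fact (k - l)))"
      using A B ij
      by (subst sum.swap) (simp add: index_mult_mat_sum[of _ n n _ n] sum_divide_distrib del: index_mult_mat(1))
    also have "\<dots> = (\<Sum>l\<le>k. of_nat (k choose l) * (A ^\<^sub>m l * B ^\<^sub>m (k - l)) $$ (i, j) / fact k)"
      by (intro sum.cong refl) (simp add: binomial_fact del: index_mult_mat)
    also have "\<dots> = ((A + B) ^\<^sub>m k) $$ (i, j) / fact k"
      unfolding binomial_mat[OF A B AB ij] by (simp add: sum_divide_distrib)
    finally show "(\<Sum>m<n. \<Sum>l\<le>k. ?a m l * ?b m (k - l)) = ((A + B) ^\<^sub>m k) $$ (i, j) / fact k" .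
  qed
  also have "\<dots> = mat_exp (A + B) $$ (i, j)" using A B ij by (simp add: index_mat_exp[of _ n])
  finally show "mat_exp (A + B) $$ (i, j) = (mat_exp A * mat_exp B) $$ (i, j)" ..
qed (use mat_exp_carrier[OF A] mat_exp_carrier[OF B] mat_exp_carrier[OF add_carrier_mat[OF B, of A]] in \<open>simp_all only: carrier_matD index_mult_mat\<close>)

lemma pow_smult_one_mat: "(c \<cdot>\<^sub>m 1\<^sub>m n) ^\<^sub>m k = (c :: 'a :: comm_semiring_1) ^ k \<cdot>\<^sub>m 1\<^sub>m n"
  by (induction k) (auto simp: mult.commute mult_smult_assoc_mat[of _ n n _ n])

lemma mat_exp_smult_one: "mat_exp (c \<cdot>\<^sub>m 1\<^sub>m n) = exp c \<cdot>\<^sub>m 1\<^sub>m n"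
proof (rule eq_matI)
  fix i j assume "i < dim_row (exp c \<cdot>\<^sub>m 1\<^sub>m n)" "j < dim_col (exp c \<cdot>\<^sub>m 1\<^sub>m n)"
  then have ij: "i < n" "j < n" by auto
  then show "mat_exp (c \<cdot>\<^sub>m 1\<^sub>m n) $$ (i, j) = (exp c \<cdot>\<^sub>m 1\<^sub>m n) $$ (i, j)"
    by (simp add: index_mat_exp[of _ n] pow_smult_one_mat exp_def scaleR_conv_of_real divide_inverse mult.commute)
qed (auto simp: mat_exp_def)

lemma mat_exp_inverse:
  assumes A: "A \<in> carrier_mat n n"
  shows "mat_exp A * mat_exp (- A) = 1\<^sub>m n"
proof -
  have "mat_exp A * mat_exp (- A) = mat_exp (A + - A)"
    using A by (subst mat_exp_add[of _ n]) auto
  \<comment> \<open>The zero matrix is written as a multiple of the identity so that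
    \<open>mat_exp_smult_one\<close> evaluates its exponential.\<close>
  also have "A + - A = 0 \<cdot>\<^sub>m 1\<^sub>m n" using A by (intro eq_matI) auto
  also have "mat_exp \<dots> = 1\<^sub>m n" unfolding mat_exp_smult_one by (intro eq_matI) auto
  finally show ?thesis .
qed

text \<open>The eigenvalue equation for the commutator says that \<open>Z\<close> intertwines
  \<open>A\<close> with \<open>A\<close> shifted by the scalar \<open>c\<close>. The shift commutes
  with \<open>A\<close>, so it leaves the exponential as the factor \<open>exp c\<close>; no series
  of nested commutators is needed.\<close>

lemma mat_exp_eigen:
  assumes A: "A \<in> carrier_mat n n" and Z: "Z \<in> carrier_mat n n" and AZ: "A * Z = Z * A + c \<cdot>\<^sub>m Z"
  shows "mat_exp A * Z * mat_exp (- A) = exp c \<cdot>\<^sub>m Z"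
proof -
  let ?C = "c \<cdot>\<^sub>m 1\<^sub>m n"
  have C: "?C \<in> carrier_mat n n" by simp
  have CA: "?C * A = A * ?C" using A
    by (simp add: mult_smult_assoc_mat[of _ n n _ n] mult_smult_distrib[of _ n n _ n])
  have "A * Z = Z * (?C + A)"
    using A Z by (simp add: AZ mult_add_distrib_mat[of _ n n _ n] mult_smult_distrib[of _ n n _ n] comm_add_mat[of _ n n])
  then have "mat_exp A * Z = Z * mat_exp (?C + A)"
    by (intro mat_exp_comm[of _ n]) (use A Z in auto)
  also have "\<dots> = exp c \<cdot>\<^sub>m (Z * mat_exp A)"
    unfolding mat_exp_add[OF C A CA] mat_exp_smult_one using A Z
    by (simp add: mult_smult_assoc_mat[of _ n n _ n] mult_smult_distrib[of _ n n _ n]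
        left_mult_one_mat[OF mat_exp_carrier])
  finally have "mat_exp A * Z * mat_exp (- A) = exp c \<cdot>\<^sub>m (Z * (mat_exp A * mat_exp (- A)))"
    using A Z by (simp add: mult_smult_assoc_mat[of _ n n _ n] assoc_mult_mat[of _ n n _ n _ n])
  then show ?thesis using Z by (simp add: mat_exp_inverse[OF A])
qed

text \<open>On the span of \<open>X\<close> and \<open>Y\<close> the commutator with
  \<open>A\<close> is an infinitesimal rotation. It is diagonalised by \<open>P\<close> and
  \<open>N\<close>, with eigenvalues i t and -i t, and Euler's formula brings the result back to
  \<open>X\<close> and \<open>Y\<close>.\<close>

lemma mat_exp_rotation:
  fixes t :: real
  assumes A: "A \<in> carrier_mat n n" and X: "X \<in> carrier_mat n n" and Y: "Y \<in> carrier_mat n n"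
    and AX: "A * X = X * A - of_real t \<cdot>\<^sub>m Y" and AY: "A * Y = Y * A + of_real t \<cdot>\<^sub>m X"
  shows "mat_exp A * X * mat_exp (- A) = of_real (cos t) \<cdot>\<^sub>m X - of_real (sin t) \<cdot>\<^sub>m Y"
proof -
  define P where "P = X + \<i> \<cdot>\<^sub>m Y"
  define N where "N = X + (- \<i>) \<cdot>\<^sub>m Y"
  define E F where "E = mat_exp A" and "F = mat_exp (- A)"
  have car: "P \<in> carrier_mat n n" "N \<in> carrier_mat n n" "E \<in> carrier_mat n n" "F \<in> carrier_mat n n"
    using A X Y by (auto simp: P_def N_def E_def F_def)
  \<comment> \<open>The commutator of \<open>A\<close> with X + c Y is c t X - t Y = c t (X - Y /
    c), and -1/c = c exactly when c squared is -1. This treats both signs of i at once.\<close>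
  have AP: "A * (X + c \<cdot>\<^sub>m Y) = (X + c \<cdot>\<^sub>m Y) * A + (c * of_real t) \<cdot>\<^sub>m (X + c \<cdot>\<^sub>m Y)" if "c * c = -1" for c
  proof -
    have "A * (X + c \<cdot>\<^sub>m Y) = A * X + c \<cdot>\<^sub>m (A * Y)"
      using A X Y by (simp add: mult_add_distrib_mat[of _ n n _ n] mult_smult_distrib[of _ n n _ n])
    moreover have "(X + c \<cdot>\<^sub>m Y) * A = X * A + c \<cdot>\<^sub>m (Y * A)"
      using A X Y by (simp add: add_mult_distrib_mat[of _ n n _ _ n] mult_smult_assoc_mat[of _ n n _ n])
    moreover have "(X * A - of_real t \<cdot>\<^sub>m Y) + c \<cdot>\<^sub>m (Y * A + of_real t \<cdot>\<^sub>m X)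
       = (X * A + c \<cdot>\<^sub>m (Y * A)) + (c * of_real t) \<cdot>\<^sub>m (X + c \<cdot>\<^sub>m Y)"
    proof (rule eq_matI, goal_cases)
      case (1 i j)
      have cc: "c * (c * y) = - y" for y
        using that by (simp add: mult.assoc[symmetric])
      then show ?case
        using 1 A X Y by (simp add: algebra_simps cc del: index_mult_mat(1))
    qed (use A X Y in auto)
    ultimately show ?thesis by (simp only: AX AY)
  qed
  have P: "E * P * F = exp (\<i> * of_real t) \<cdot>\<^sub>m P" and N: "E * N * F = exp (- \<i> * of_real t) \<cdot>\<^sub>m N"
    unfolding E_def F_def using AP[of \<i>] AP[of "- \<i>"] car
    by (auto intro!: mat_exp_eigen[OF A] simp: P_def N_def)
  have XPN: "X = (1/2) \<cdot>\<^sub>m (P + N)" using X Y by (intro eq_matI) (auto simp: P_def N_def)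
  have "E * X * F = (1/2) \<cdot>\<^sub>m (E * P * F + E * N * F)"
    unfolding XPN using car
    by (simp add: mult_smult_assoc_mat[of _ n n _ n] mult_smult_distrib[of _ n n _ n]
        mult_add_distrib_mat[of _ n n _ n] add_mult_distrib_mat[of _ n n _ _ n])
  also have "\<dots> = (1/2) \<cdot>\<^sub>m (exp (\<i> * of_real t) \<cdot>\<^sub>m P + exp (- \<i> * of_real t) \<cdot>\<^sub>m N)"
    by (simp only: P N)
  also have "\<dots> = of_real (cos t) \<cdot>\<^sub>m X - of_real (sin t) \<cdot>\<^sub>m Y"
  proof (rule eq_matI, goal_cases)
    case (1 i j)
    have e: "exp (\<i> * of_real t) = of_real (cos t) + \<i> * of_real (sin t)"
      "exp (- \<i> * of_real t) = of_real (cos t) - \<i> * of_real (sin t)"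
      using cis_conv_exp[of t] cis_conv_exp[of "- t"] by (auto simp: cis.ctr complex_eq_iff)
    show ?case unfolding e
      using 1 X Y by (simp add: P_def N_def field_simps)
  qed (use X Y in \<open>auto simp: P_def N_def\<close>)
  finally show ?thesis by (simp add: E_def F_def)
qed

subsection \<open>Canonical anticommutation relations\<close>

text \<open>A weighted partial map of the standard unit vectors: column \<open>c\<close> goes to
  \<open>s c\<close> times unit vector \<open>f c\<close> where \<open>P c\<close> holds and to zero
  elsewhere. Annihilators, creators and their products all have this form, so operator identities
  reduce to identities between bits and signs.\<close>

definition shift_mat :: "nat \<Rightarrow> (nat \<Rightarrow> bool) \<Rightarrow> (nat \<Rightarrow> nat) \<Rightarrow> (nat \<Rightarrow> complex) \<Rightarrow> complex mat" where
  "shift_mat d P f s = mat d d (\<lambda>(r, c). if P c \<and> r = f c then s c else 0)"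

lemma shift_mat_carrier [simp]: "shift_mat d P f s \<in> carrier_mat d d"
  by (simp add: shift_mat_def)

text \<open>The hypothesis keeps the intermediate index in range. Were \<open>g c\<close> at least
  \<open>d\<close>, column \<open>c\<close> of the product would vanish, while the right-hand side
  could still have an entry at \<open>f (g c)\<close>.\<close>

lemma shift_mat_mult:
  assumes "\<And>c. c < d \<Longrightarrow> Q c \<Longrightarrow> g c < d"
  shows "shift_mat d P f s * shift_mat d Q g t
       = shift_mat d (\<lambda>c. Q c \<and> P (g c)) (\<lambda>c. f (g c)) (\<lambda>c. s (g c) * t c)"
proof (rule eq_matI)
  fix r c
  assume "r < dim_row (shift_mat d (\<lambda>c. Q c \<and> P (g c)) (\<lambda>c. f (g c)) (\<lambda>c. s (g c) * t c))"
    "c < dim_col (shift_mat d (\<lambda>c. Q c \<and> P (g c)) (\<lambda>c. f (g c)) (\<lambda>c. s (g c) * t c))"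
  then have rc: "r < d" "c < d" by (auto simp: shift_mat_def)
  have "(shift_mat d P f s * shift_mat d Q g t) $$ (r, c)
      = (\<Sum>m\<in>{0..<d}. (if P m \<and> r = f m then s m else 0) * (if Q c \<and> m = g c then t c else 0))"
    using rc by (simp add: shift_mat_def scalar_prod_def)
  also have "\<dots> = (\<Sum>m\<in>{0..<d}. if m = g c then (if Q c \<and> P m \<and> r = f m then s m * t c else 0) else 0)"
    by (intro sum.cong) auto
  also have "\<dots> = shift_mat d (\<lambda>c. Q c \<and> P (g c)) (\<lambda>c. f (g c)) (\<lambda>c. s (g c) * t c) $$ (r, c)"
    using rc assms by (auto simp: shift_mat_def)
  finally show "(shift_mat d P f s * shift_mat d Q g t) $$ (r, c) = \<dots>" .
qed (auto simp: shift_mat_def)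

text \<open>Emptying mode \<open>q\<close> lowers the count to the left of \<open>p\<close> by one
  precisely when \<open>q\<close> lies left of \<open>p\<close> and was occupied. This sign is the
  source of all the anticommutation relations below.\<close>

lemma occ_left_unset_bit:
  "(-1 :: complex) ^ occ_left (unset_bit q c) p = (if q < p \<and> bit c q then -1 else 1) * (-1) ^ occ_left c p"
proof (cases "q < p \<and> bit c q")
  case True
  then have "occ_left c p = of_bool (bit c q) + (\<Sum>j\<in>{..<p} - {q}. of_bool (bit c j))"
    unfolding occ_left_def by (subst sum.remove[of _ q]) auto
  moreover have "occ_left (unset_bit q c) p = 0 + (\<Sum>j\<in>{..<p} - {q}. of_bool (bit c j))"
    unfolding occ_left_def using True by (subst sum.remove[of _ q]) (auto simp: bit_simps intro!: sum.cong)
  ultimately show ?thesis using True by simp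
next
  case False
  then have "occ_left (unset_bit q c) p = occ_left c p"
    unfolding occ_left_def by (intro sum.cong refl) (auto simp: bit_simps)
  then show ?thesis using False by simp
qed

lemma occ_left_set_bit:
  "(-1 :: complex) ^ occ_left (Bit_Operations.set_bit q c) p
     = (if q < p \<and> \<not> bit c q then -1 else 1) * (-1) ^ occ_left c p"
proof (cases "bit c q")
  case True
  then have "Bit_Operations.set_bit q c = c" by (auto intro!: bit_eqI simp: bit_simps)
  then show ?thesis using True by simp
next
  case False
  then have "unset_bit q (Bit_Operations.set_bit q c) = c" by (auto intro!: bit_eqI simp: bit_simps)
  then show ?thesis
    using occ_left_unset_bit[of q "Bit_Operations.set_bit q c" p] False by (auto simp: bit_simps)
qed

text \<open>Makes the range condition on indices a statement about bits, so that it visibly survives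
  setting or clearing a bit below \<open>n\<close>.\<close>

lemma less_two_power_iff_bit: "(c :: nat) < 2 ^ n \<longleftrightarrow> (\<forall>j\<ge>n. \<not> bit c j)"
proof
  assume c: "c < 2 ^ n"
  have "take_bit n c = c" using c by (rule take_bit_nat_eq_self)
  then show "\<forall>j\<ge>n. \<not> bit c j" by (metis bit_take_bit_iff not_le)
next
  assume "\<forall>j\<ge>n. \<not> bit c j"
  then have "take_bit n c = c" by (intro bit_eqI) (metis bit_take_bit_iff not_le)
  then show "c < 2 ^ n" by (simp add: take_bit_nat_eq_self_iff)
qed

lemma unset_bit_less_two_power: "(c :: nat) < 2 ^ n \<Longrightarrow> unset_bit p c < 2 ^ n"
  and set_bit_less_two_power: "(c :: nat) < 2 ^ n \<Longrightarrow> p < n \<Longrightarrow> Bit_Operations.set_bit p c < 2 ^ n"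
  by (auto simp: less_two_power_iff_bit bit_simps)

section \<open>Modes and their operators\<close>

lemma mode_pos_eq:
  assumes "distinct ks" "j < length ks"
  shows "mode_pos ks (ks ! j) \<sigma> = 2 * j + (case \<sigma> of Up \<Rightarrow> 0 | Down \<Rightarrow> 1)"
proof -
  have "(THE i. i < length ks \<and> ks ! i = ks ! j) = j"
    using assms by (intro the_equality) (auto simp: nth_eq_iff_index_eq)
  then show ?thesis by (simp add: mode_pos_def)
qed

lemma mode_pos_less: "distinct ks \<Longrightarrow> k \<in> set ks \<Longrightarrow> mode_pos ks k \<sigma> < 2 * length ks"
  by (auto simp: in_set_conv_nth mode_pos_eq split: spin.split)

lemma mode_pos_inj:
  assumes "distinct ks" "k \<in> set ks" "k' \<in> set ks" "mode_pos ks k \<sigma> = mode_pos ks k' \<tau>"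
  shows "k = k' \<and> \<sigma> = \<tau>"
proof -
  obtain j j' where "j < length ks" "k = ks ! j" "j' < length ks" "k' = ks ! j'"
    using assms(2,3) by (auto simp: in_set_conv_nth)
  then show ?thesis
    using assms(1,4) by (cases \<sigma>; cases \<tau>) (auto simp: mode_pos_eq, presburger+)
qed

lemma annih_eq_shift_mat:
  "annih ks k \<sigma> = shift_mat (fock_dim ks) (\<lambda>c. bit c (mode_pos ks k \<sigma>))
     (unset_bit (mode_pos ks k \<sigma>)) (\<lambda>c. (-1) ^ occ_left c (mode_pos ks k \<sigma>))"
  by (simp add: annih_def shift_mat_def Let_def)

lemma creat_eq_shift_mat:
  "creat ks k \<sigma> = shift_mat (fock_dim ks) (\<lambda>c. \<not> bit c (mode_pos ks k \<sigma>))
     (Bit_Operations.set_bit (mode_pos ks k \<sigma>)) (\<lambda>c. (-1) ^ occ_left c (mode_pos ks k \<sigma>))"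
  by (simp add: creat_def shift_mat_def Let_def)

lemma annih_carrier [simp]: "annih ks k \<sigma> \<in> carrier_mat (fock_dim ks) (fock_dim ks)"
  and creat_carrier [simp]: "creat ks k \<sigma> \<in> carrier_mat (fock_dim ks) (fock_dim ks)"
  by (simp_all add: annih_eq_shift_mat creat_eq_shift_mat)

lemma shift_mat_eq_uminus:
  assumes "\<And>c. c < d \<Longrightarrow> P c \<longleftrightarrow> Q c"
    and "\<And>c. c < d \<Longrightarrow> P c \<Longrightarrow> f c = g c" "\<And>c. c < d \<Longrightarrow> P c \<Longrightarrow> s c = - t c"
  shows "shift_mat d P f s = - shift_mat d Q g t"
  using assms by (intro eq_matI) (auto simp: shift_mat_def)

context
  fixes ks :: "(real^3) list"
  assumes ks: "distinct ks"
begin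

lemma shift_mat_mult_unset_bit:
  assumes "k \<in> set ks"
  shows "shift_mat (fock_dim ks) P f s * shift_mat (fock_dim ks) Q (unset_bit (mode_pos ks k \<sigma>)) t
    = shift_mat (fock_dim ks) (\<lambda>c. Q c \<and> P (unset_bit (mode_pos ks k \<sigma>) c))
        (\<lambda>c. f (unset_bit (mode_pos ks k \<sigma>) c)) (\<lambda>c. s (unset_bit (mode_pos ks k \<sigma>) c) * t c)"
  using assms mode_pos_less[OF ks]
  by (intro shift_mat_mult) (auto simp: fock_dim_def unset_bit_less_two_power)

lemma shift_mat_mult_set_bit:
  assumes "k \<in> set ks"
  shows "shift_mat (fock_dim ks) P f s * shift_mat (fock_dim ks) Q (Bit_Operations.set_bit (mode_pos ks k \<sigma>)) t
    = shift_mat (fock_dim ks) (\<lambda>c. Q c \<and> P (Bit_Operations.set_bit (mode_pos ks k \<sigma>) c))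
        (\<lambda>c. f (Bit_Operations.set_bit (mode_pos ks k \<sigma>) c))
        (\<lambda>c. s (Bit_Operations.set_bit (mode_pos ks k \<sigma>) c) * t c)"
  using assms mode_pos_less[OF ks]
  by (intro shift_mat_mult) (auto simp: fock_dim_def set_bit_less_two_power)

text \<open>For different modes the two bit changes commute, and only the operator further to the
  right sees its sign altered by the other one. For equal modes both products vanish because the bit
  is already cleared.\<close>

lemma annih_annih:
  assumes k: "k \<in> set ks" "k' \<in> set ks"
  shows "annih ks k \<sigma> * annih ks k' \<tau> = - (annih ks k' \<tau> * annih ks k \<sigma>)"
proof -
  let ?p = "mode_pos ks k \<sigma>" and ?q = "mode_pos ks k' \<tau>"
  have comm: "unset_bit ?p (unset_bit ?q c) = unset_bit ?q (unset_bit ?p c)" for c :: nat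
    by (auto intro!: bit_eqI simp: bit_simps)
  show ?thesis
    unfolding annih_eq_shift_mat shift_mat_mult_unset_bit[OF k(1)] shift_mat_mult_unset_bit[OF k(2)]
    by (rule shift_mat_eq_uminus; cases ?p ?q rule: linorder_cases)
      (auto simp: comm bit_simps occ_left_unset_bit)
qed

text \<open>Different modes occupy different positions by \<open>mode_pos_inj\<close>, so again
  exactly one order of the two operators picks up an extra sign.\<close>

lemma annih_creat:
  assumes k: "k \<in> set ks" "k' \<in> set ks" and ne: "k \<noteq> k' \<or> \<sigma> \<noteq> \<tau>"
  shows "annih ks k \<sigma> * creat ks k' \<tau> = - (creat ks k' \<tau> * annih ks k \<sigma>)"
proof -
  let ?p = "mode_pos ks k \<sigma>" and ?q = "mode_pos ks k' \<tau>"
  have pq: "?p \<noteq> ?q" using mode_pos_inj[OF ks k] ne by blast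
  then have comm: "unset_bit ?p (Bit_Operations.set_bit ?q c) = Bit_Operations.set_bit ?q (unset_bit ?p c)" for c :: nat
    by (auto intro!: bit_eqI simp: bit_simps)
  show ?thesis
    unfolding annih_eq_shift_mat creat_eq_shift_mat
      shift_mat_mult_unset_bit[OF k(1)] shift_mat_mult_set_bit[OF k(2)]
    by (rule shift_mat_eq_uminus; cases ?p ?q rule: linorder_cases)
      (use pq in \<open>auto simp: comm bit_simps occ_left_unset_bit occ_left_set_bit\<close>)
qed

lemma creat_creat:
  assumes k: "k \<in> set ks" "k' \<in> set ks"
  shows "creat ks k \<sigma> * creat ks k' \<tau> = - (creat ks k' \<tau> * creat ks k \<sigma>)"
proof -
  let ?p = "mode_pos ks k \<sigma>" and ?q = "mode_pos ks k' \<tau>"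
  have comm: "Bit_Operations.set_bit ?p (Bit_Operations.set_bit ?q c)
      = Bit_Operations.set_bit ?q (Bit_Operations.set_bit ?p c)" for c :: nat
    by (auto intro!: bit_eqI simp: bit_simps)
  show ?thesis
    unfolding creat_eq_shift_mat shift_mat_mult_set_bit[OF k(1)] shift_mat_mult_set_bit[OF k(2)]
    by (rule shift_mat_eq_uminus; cases ?p ?q rule: linorder_cases)
      (auto simp: comm bit_simps occ_left_set_bit)
qed

text \<open>Both products are diagonal: they project onto the unit vectors in which the mode is
  empty or occupied, respectively. The signs cancel in pairs since changing bit \<open>?p\<close>
  does not affect the occupation to its left.\<close>

lemma annih_creat_same:
  assumes k: "k \<in> set ks"
  shows "annih ks k \<sigma> * creat ks k \<sigma> = 1\<^sub>m (fock_dim ks) - creat ks k \<sigma> * annih ks k \<sigma>"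
proof -
  let ?p = "mode_pos ks k \<sigma>"
  have "\<not> bit c ?p \<Longrightarrow> unset_bit ?p (Bit_Operations.set_bit ?p c) = c"
    "bit c ?p \<Longrightarrow> Bit_Operations.set_bit ?p (unset_bit ?p c) = c" for c :: nat
    by (auto intro!: bit_eqI simp: bit_simps)
  moreover have "(-1 :: complex) ^ occ_left c ?p * (-1) ^ occ_left c ?p = 1" for c
    by (simp add: power_mult_distrib[symmetric])
  ultimately show ?thesis
    unfolding annih_eq_shift_mat creat_eq_shift_mat
      shift_mat_mult_unset_bit[OF k] shift_mat_mult_set_bit[OF k]
    by (intro eq_matI) (auto simp: shift_mat_def bit_simps occ_left_unset_bit occ_left_set_bit)
qed

end

subsection \<open>The Bogoliubov rotation\<close>

lemma finsum_mat_carrier: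
  assumes "finite S" "\<And>k. k \<in> S \<Longrightarrow> f k \<in> carrier_mat n n"
  shows "(\<Oplus>\<^bsub>module_mat TYPE('a :: comm_ring_1) n n\<^esub>k\<in>S. f k) \<in> carrier_mat n n"
proof -
  interpret M: abelian_group "module_mat TYPE('a) n n" by (rule abelian_group_mat)
  show ?thesis using assms M.finsum_closed[of f S] by (auto simp: module_mat_simps)
qed

lemma index_finsum_mat:
  assumes "finite S" "\<And>k. k \<in> S \<Longrightarrow> f k \<in> carrier_mat n n" "i < n" "j < n"
  shows "(\<Oplus>\<^bsub>module_mat TYPE('a :: comm_ring_1) n n\<^esub>k\<in>S. f k) $$ (i, j) = (\<Sum>k\<in>S. f k $$ (i, j))"
  using assms(1,2)
proof (induction S rule: finite_induct)
  interpret M: abelian_group "module_mat TYPE('a) n n" by (rule abelian_group_mat)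
  case empty
  show ?case using assms by (simp add: module_mat_simps)
next
  interpret M: abelian_group "module_mat TYPE('a) n n" by (rule abelian_group_mat)
  case (insert k S)
  have "(\<Oplus>\<^bsub>module_mat TYPE('a) n n\<^esub>k\<in>insert k S. f k) = f k + (\<Oplus>\<^bsub>module_mat TYPE('a) n n\<^esub>k\<in>S. f k)"
    using insert M.finsum_insert[of S k f] by (auto simp: module_mat_simps)
  moreover have "(\<Oplus>\<^bsub>module_mat TYPE('a) n n\<^esub>k\<in>S. f k) \<in> carrier_mat n n"
    using insert by (intro finsum_mat_carrier) auto
  ultimately show ?case using insert assms(3,4) by simp
qed

text \<open>Meant for the generator \<open>G_B\<close>: each mode belongs to exactly one pair, so
  only the summand \<open>q\<close> fails to commute with \<open>Z\<close> and contributes the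
  correction \<open>W\<close>.\<close>

lemma finsum_mat_commutator:
  fixes B :: "'k \<Rightarrow> 'a :: comm_ring_1 mat"
  assumes S: "finite S" "q \<in> S" and B: "\<And>k. k \<in> S \<Longrightarrow> B k \<in> carrier_mat n n"
    and Z: "Z \<in> carrier_mat n n" and W: "W \<in> carrier_mat n n"
    and other: "\<And>k. k \<in> S \<Longrightarrow> k \<noteq> q \<Longrightarrow> B k * Z = Z * B k"
    and self: "B q * Z = Z * B q + W"
  shows "(\<Oplus>\<^bsub>module_mat TYPE('a) n n\<^esub>k\<in>S. B k) * Z = Z * (\<Oplus>\<^bsub>module_mat TYPE('a) n n\<^esub>k\<in>S. B k) + W"
proof -
  define T where "T = (\<Oplus>\<^bsub>module_mat TYPE('a) n n\<^esub>k\<in>S. B k)"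
  have T: "T \<in> carrier_mat n n" unfolding T_def by (rule finsum_mat_carrier[OF S(1) B])
  have Tij: "T $$ (i, j) = (\<Sum>k\<in>S. B k $$ (i, j))" if "i < n" "j < n" for i j
    unfolding T_def by (rule index_finsum_mat[OF S(1) B that])
  have "T * Z = Z * T + W"
  proof (rule eq_matI)
    fix i j assume "i < dim_row (Z * T + W)" "j < dim_col (Z * T + W)"
    then have ij: "i < n" "j < n" using W by auto
    have "(T * Z) $$ (i, j) = (\<Sum>k\<in>S. (B k * Z) $$ (i, j))"
      using T Z B ij
      by (simp add: index_mult_mat_sum[of _ n n _ n] Tij sum_distrib_right sum.swap[of _ "{..<n}"] del: index_mult_mat(1))
    also have "\<dots> = (\<Sum>k\<in>S. (Z * B k) $$ (i, j) + (if k = q then W $$ (i, j) else 0))"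
      using other self Z W B ij by (intro sum.cong) (auto simp del: index_mult_mat(1))
    also have "\<dots> = (\<Sum>k\<in>S. (Z * B k) $$ (i, j)) + W $$ (i, j)"
      using S by (simp add: sum.distrib del: index_mult_mat(1))
    also have "(\<Sum>k\<in>S. (Z * B k) $$ (i, j)) = (Z * T) $$ (i, j)"
      using T Z B ij
      by (simp add: index_mult_mat_sum[of _ n n _ n] Tij sum_distrib_left sum.swap[of _ "{..<n}"] del: index_mult_mat(1))
    finally show "(T * Z) $$ (i, j) = (Z * T + W) $$ (i, j)"
      using T Z W ij by (simp del: index_mult_mat(1))
  qed (use T Z W in auto)
  then show ?thesis by (simp add: T_def)
qed

section \<open>Commutators with a product of two fermionic operators\<close>

context
  fixes n :: nat and X Y Z :: "'a :: comm_ring_1 mat"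
  assumes car: "X \<in> carrier_mat n n" "Y \<in> carrier_mat n n" "Z \<in> carrier_mat n n"
begin

text \<open>This and the next two lemmas are cases of [XY, Z] = X {Y, Z} - {X, Z} Y, where {X, Z} =
  XZ + ZX. Here both anticommutators vanish; below, one of them is the identity.\<close>

lemma pair_commute_of_anticomm:
  assumes "X * Z = - (Z * X)" "Y * Z = - (Z * Y)"
  shows "X * Y * Z = Z * (X * Y)"
proof -
  have "X * Y * Z = - (X * Z) * Y"
    using car assms(2) by (simp add: assoc_mult_mat[of _ n n _ n _ n])
  then show ?thesis
    using car by (simp add: assms(1) assoc_mult_mat[of _ n n _ n _ n])
qed

lemma pair_commutator_of_car_left:
  assumes "X * Z = 1\<^sub>m n - Z * X" "Y * Z = - (Z * Y)"
  shows "X * Y * Z = Z * (X * Y) + - Y"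
proof -
  have "X * Y * Z = - ((X * Z) * Y)"
    using car assms(2) by (simp add: assoc_mult_mat[of _ n n _ n _ n])
  also have "(X * Z) * Y = Y - Z * (X * Y)"
    using car by (simp add: assms(1) minus_mult_distrib_mat[of _ n n _ _ n] assoc_mult_mat[of _ n n _ n _ n])
  also have "- \<dots> = Z * (X * Y) + - Y" using car by (intro eq_matI) auto
  finally show ?thesis .
qed

lemma pair_commutator_of_car_right:
  assumes "X * Z = - (Z * X)" "Y * Z = 1\<^sub>m n - Z * Y"
  shows "X * Y * Z = Z * (X * Y) + X"
proof -
  have "X * Y * Z = X - (X * Z) * Y"
    using car assms(2) by (simp add: mult_minus_distrib_mat[of _ n n _ n] assoc_mult_mat[of _ n n _ n _ n])
  also have "\<dots> = Z * (X * Y) + X"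
    using car by (intro eq_matI) (auto simp: assms(1) assoc_mult_mat[of _ n n _ n _ n])
  finally show ?thesis .
qed

end

lemma minus_mult_smult_commutator:
  fixes t :: "'a :: comm_ring_1"
  assumes "b \<in> carrier_mat n n" "b' \<in> carrier_mat n n" "Z \<in> carrier_mat n n"
    and "V \<in> carrier_mat n n" "V' \<in> carrier_mat n n"
    and "b * Z = Z * b + V" "b' * Z = Z * b' + V'"
  shows "(t \<cdot>\<^sub>m (b - b')) * Z = Z * (t \<cdot>\<^sub>m (b - b')) + t \<cdot>\<^sub>m (V - V')"
proof -
  have "(t \<cdot>\<^sub>m (b - b')) * Z = t \<cdot>\<^sub>m (b * Z - b' * Z)"
    using assms(1-3) by (simp add: minus_carrier_mat mult_smult_assoc_mat[of _ n n _ n] minus_mult_distrib_mat[of _ n n _ _ n])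
  moreover have "Z * (t \<cdot>\<^sub>m (b - b')) = t \<cdot>\<^sub>m (Z * b - Z * b')"
    using assms(1-3) by (simp add: minus_carrier_mat mult_smult_distrib[of _ n n _ n] mult_minus_distrib_mat[of _ n n _ n])
  moreover have "t \<cdot>\<^sub>m (Z * b + V - (Z * b' + V')) = t \<cdot>\<^sub>m (Z * b - Z * b') + t \<cdot>\<^sub>m (V - V')"
    using assms(1-5) by (intro eq_matI) (auto simp: algebra_simps)
  ultimately show ?thesis by (simp only: assms(6,7))
qed

section \<open>Adjoints and products of linear combinations\<close>

lemma mat_adjoint_carrier [simp]: "A \<in> carrier_mat n n \<Longrightarrow> mat_adjoint A \<in> carrier_mat n n"
  by (auto simp: mat_adjoint_def)

lemma index_mat_adjoint:
  "A \<in> carrier_mat n n \<Longrightarrow> i < n \<Longrightarrow> j < n \<Longrightarrow> mat_adjoint A $$ (i, j) = conjugate (A $$ (j, i))"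
  by (simp add: mat_adjoint_def mat_of_rows_index)

lemma annih_eq_adjoint_creat: "annih ks k \<sigma> = mat_adjoint (creat ks k \<sigma>)"
proof -
  note car = annih_carrier[of ks k \<sigma>]
  note dims = carrier_matD[OF car] carrier_matD[OF mat_adjoint_carrier[OF mat_adjoint_carrier[OF car]]]
  show ?thesis
    unfolding creat_eq_adjoint_annih
    by (intro eq_matI) (auto simp: dims index_mat_adjoint[of _ "fock_dim ks"])
qed

lemma mat_adjoint_diff_smult:
  fixes X Y :: "complex mat" and c s :: real
  assumes "X \<in> carrier_mat n n" "Y \<in> carrier_mat n n"
  shows "mat_adjoint (of_real c \<cdot>\<^sub>m X - of_real s \<cdot>\<^sub>m Y) = of_real c \<cdot>\<^sub>m mat_adjoint X - of_real s \<cdot>\<^sub>m mat_adjoint Y"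
proof -
  let ?C = "of_real c \<cdot>\<^sub>m X - of_real s \<cdot>\<^sub>m Y"
  have C: "?C \<in> carrier_mat n n" using assms by (simp add: minus_carrier_mat)
  note dims = carrier_matD[OF mat_adjoint_carrier[OF C]] carrier_matD[OF mat_adjoint_carrier[OF assms(1)]]
    carrier_matD[OF mat_adjoint_carrier[OF assms(2)]]
  show ?thesis
  proof (rule eq_matI, goal_cases)
    case (1 i j)
    then have ij: "i < n" "j < n" by (simp_all add: dims)
    have "mat_adjoint ?C $$ (i, j) = cnj (?C $$ (j, i))"
      by (simp add: index_mat_adjoint[OF C ij])
    also have "\<dots> = of_real c * cnj (X $$ (j, i)) - of_real s * cnj (Y $$ (j, i))"
      using assms ij by simp
    finally show ?case
      using ij by (simp add: dims index_mat_adjoint[OF assms(1) ij] index_mat_adjoint[OF assms(2) ij])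
  qed (simp_all add: dims)
qed

lemma index_mult_diff_smult:
  fixes X Y Z W :: "'a :: comm_ring_1 mat"
  assumes "X \<in> carrier_mat n n" "Y \<in> carrier_mat n n" "Z \<in> carrier_mat n n" "W \<in> carrier_mat n n" "i < n" "j < n"
  shows "((c \<cdot>\<^sub>m X - s \<cdot>\<^sub>m Y) * (c \<cdot>\<^sub>m Z - s \<cdot>\<^sub>m W)) $$ (i, j)
    = c * c * (X * Z) $$ (i, j) - c * s * (X * W) $$ (i, j) - c * s * (Y * Z) $$ (i, j) + s * s * (Y * W) $$ (i, j)"
proof -
  have "(c \<cdot>\<^sub>m X - s \<cdot>\<^sub>m Y) * (c \<cdot>\<^sub>m Z - s \<cdot>\<^sub>m W)
      = c \<cdot>\<^sub>m (c \<cdot>\<^sub>m (X * Z) - s \<cdot>\<^sub>m (Y * Z)) - s \<cdot>\<^sub>m (c \<cdot>\<^sub>m (X * W) - s \<cdot>\<^sub>m (Y * W))"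
    using assms(1-4)
    by (simp add: minus_carrier_mat mult_smult_assoc_mat[of _ n n _ n] minus_mult_distrib_mat[of _ n n _ _ n]
        mult_smult_distrib[of _ n n _ n] mult_minus_distrib_mat[of _ n n _ n])
  then show ?thesis using assms by (simp add: algebra_simps del: index_mult_mat(1))
qed

section \<open>Quasiparticle operators\<close>

context
  fixes ks :: "(real^3) list"
begin

abbreviation (input) d where "d \<equiv> fock_dim ks"

abbreviation (input) pair_gen :: "(real^3 \<Rightarrow> real) \<Rightarrow> real^3 \<Rightarrow> complex mat" where
  "pair_gen \<theta> k \<equiv> of_real (\<theta> k) \<cdot>\<^sub>m (pair_annih ks k - pair_creat ks k)"

lemma pair_carrier: "pair_annih ks k \<in> carrier_mat d d" "pair_creat ks k \<in> carrier_mat d d"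
  using mult_carrier_mat[OF annih_carrier annih_carrier] mult_carrier_mat[OF creat_carrier creat_carrier] by blast+

lemma pair_gen_carrier: "pair_gen \<theta> k \<in> carrier_mat d d"
  using pair_carrier[of k] by (simp add: minus_carrier_mat)

lemma pair_gen_comm:
  assumes Z: "Z \<in> carrier_mat d d"
    and "pair_annih ks k * Z = Z * pair_annih ks k" "pair_creat ks k * Z = Z * pair_creat ks k"
  shows "pair_gen \<theta> k * Z = Z * pair_gen \<theta> k"
proof -
  have "pair_gen \<theta> k * Z = Z * pair_gen \<theta> k + of_real (\<theta> k) \<cdot>\<^sub>m (0\<^sub>m d d - 0\<^sub>m d d)"
    using assms pair_carrier by (intro minus_mult_smult_commutator) auto
  moreover have "Z * pair_gen \<theta> k \<in> carrier_mat d d"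
    by (rule mult_carrier_mat[OF Z pair_gen_carrier])
  moreover have "of_real (\<theta> k) \<cdot>\<^sub>m (0\<^sub>m d d - 0\<^sub>m d d) = (0\<^sub>m d d :: complex mat)"
    by (intro eq_matI) auto
  ultimately show ?thesis by simp
qed

lemma G_B_carrier: "G_B ks \<theta> \<in> carrier_mat d d"
  unfolding G_B_def by (intro smult_carrier_mat finsum_mat_carrier finite_set pair_gen_carrier)

lemma qp_annih_carrier: "qp_annih ks \<theta> k \<sigma> \<in> carrier_mat d d"
  unfolding qp_annih_def
  by (intro mult_carrier_mat[of _ _ d] mat_exp_carrier smult_carrier_mat G_B_carrier annih_carrier)

text \<open>The factor i in the exponent meets the factor i in \<open>G_B\<close>, so
  \<open>\<i> \<cdot>\<^sub>m G_B ks \<theta>\<close> is minus the sum of the pair terms. Hence the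
  order \<open>V' - V\<close>.\<close>

lemma G_B_commutator:
  assumes q: "q \<in> set ks" and Z: "Z \<in> carrier_mat d d" and V: "V \<in> carrier_mat d d" "V' \<in> carrier_mat d d"
    and other: "\<And>k. k \<in> set ks \<Longrightarrow> k \<noteq> q \<Longrightarrow> pair_gen \<theta> k * Z = Z * pair_gen \<theta> k"
    and "pair_annih ks q * Z = Z * pair_annih ks q + V" "pair_creat ks q * Z = Z * pair_creat ks q + V'"
  shows "(\<i> \<cdot>\<^sub>m G_B ks \<theta>) * Z = Z * (\<i> \<cdot>\<^sub>m G_B ks \<theta>) + of_real (\<theta> q) \<cdot>\<^sub>m (V' - V)"
proof -
  define T where "T = (\<Oplus>\<^bsub>Op ks\<^esub>k\<in>set ks. pair_gen \<theta> k)"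
  have T: "T \<in> carrier_mat d d" unfolding T_def by (rule finsum_mat_carrier) (simp_all only: finite_set pair_gen_carrier)
  have "T * Z = Z * T + of_real (\<theta> q) \<cdot>\<^sub>m (V - V')"
    unfolding T_def using assms pair_gen_carrier pair_carrier
    by (intro finsum_mat_commutator[where q = q] minus_mult_smult_commutator) auto
  moreover have "\<i> \<cdot>\<^sub>m G_B ks \<theta> = - T"
    unfolding G_B_def T_def[symmetric] using T by (intro eq_matI) auto
  moreover have "- (T * Z) = - (Z * T) + of_real (\<theta> q) \<cdot>\<^sub>m (V' - V)" if "T * Z = Z * T + of_real (\<theta> q) \<cdot>\<^sub>m (V - V')"
    unfolding that using T Z V by (intro eq_matI) (auto simp: algebra_simps)
  ultimately show ?thesis using T Z by simp
qed

context
  assumes ks: "distinct ks" and neg: "\<And>k. k \<in> set ks \<Longrightarrow> - k \<in> set ks"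
begin

lemma creat_annih:
  assumes k: "k \<in> set ks" "k' \<in> set ks" and ne: "k \<noteq> k' \<or> \<sigma> \<noteq> \<tau>"
  shows "creat ks k \<sigma> * annih ks k' \<tau> = - (annih ks k' \<tau> * creat ks k \<sigma>)"
proof -
  have "annih ks k' \<tau> * creat ks k \<sigma> = - (creat ks k \<sigma> * annih ks k' \<tau>)"
    using ne by (intro annih_creat[OF ks k(2,1)]) auto
  then show ?thesis by simp
qed

lemma creat_annih_same:
  assumes k: "k \<in> set ks"
  shows "creat ks k \<sigma> * annih ks k \<sigma> = 1\<^sub>m d - annih ks k \<sigma> * creat ks k \<sigma>"
  unfolding annih_creat_same[OF ks k]
  using mult_carrier_mat[OF creat_carrier[of ks k \<sigma>] annih_carrier[of ks k \<sigma>]]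
  by (intro eq_matI) (auto simp del: index_mult_mat(1))

text \<open>A mode other than the two in the pair anticommutes with both factors, and the two signs
  cancel. For zero momentum the two modes of the pair differ by spin alone, which is why the
  exclusions compare momentum and spin together.\<close>

lemma pair_comm:
  assumes k: "k \<in> set ks" and q: "q \<in> set ks" and ne: "(q, \<tau>) \<noteq> (k, Up)" "(q, \<tau>) \<noteq> (- k, Down)"
  shows "pair_annih ks k * annih ks q \<tau> = annih ks q \<tau> * pair_annih ks k"
    and "pair_annih ks k * creat ks q \<tau> = creat ks q \<tau> * pair_annih ks k"
    and "pair_creat ks k * annih ks q \<tau> = annih ks q \<tau> * pair_creat ks k"
    and "pair_creat ks k * creat ks q \<tau> = creat ks q \<tau> * pair_creat ks k"
  using ne annih_annih[OF ks _ q] creat_creat[OF ks _ q] annih_creat[OF ks _ q] creat_annih[OF _ q] k neg[OF k]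
  by (auto intro!: pair_commute_of_anticomm[of _ d])

text \<open>The second combination is written with \<open>- sin\<close> so that both operators have
  the shape c X - s Y expected by \<open>mat_adjoint_diff_smult\<close> and
  \<open>index_mult_diff_smult\<close>.\<close>

lemma qp_annih_eq:
  assumes k: "k \<in> set ks"
  shows "qp_annih ks \<theta> k Up = of_real (cos (\<theta> k)) \<cdot>\<^sub>m annih ks k Up - of_real (sin (\<theta> k)) \<cdot>\<^sub>m creat ks (- k) Down"
    and "qp_annih ks \<theta> (- k) Down
       = of_real (cos (\<theta> k)) \<cdot>\<^sub>m annih ks (- k) Down - of_real (- sin (\<theta> k)) \<cdot>\<^sub>m creat ks k Up"
proof -
  note nk = neg[OF k]
  have iG: "\<i> \<cdot>\<^sub>m G_B ks \<theta> \<in> carrier_mat d d" and mG: "(- \<i>) \<cdot>\<^sub>m G_B ks \<theta> = - (\<i> \<cdot>\<^sub>m G_B ks \<theta>)"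
    using G_B_carrier[of \<theta>] by (auto intro!: eq_matI)
  have other: "pair_gen \<theta> k' * annih ks q \<tau> = annih ks q \<tau> * pair_gen \<theta> k'"
      "pair_gen \<theta> k' * creat ks q \<tau> = creat ks q \<tau> * pair_gen \<theta> k'"
    if "k' \<in> set ks" "q \<in> set ks" "(q, \<tau>) \<noteq> (k', Up)" "(q, \<tau>) \<noteq> (- k', Down)" for k' q \<tau>
    using pair_comm[OF that] by (auto intro: pair_gen_comm)
  note car = annih_annih[OF ks] creat_creat[OF ks] annih_creat[OF ks] creat_annih
    annih_creat_same[OF ks] creat_annih_same
  \<comment> \<open>Commuting is stated with a zero correction to fit the shape of the premises of
    \<open>G_B_commutator\<close>.\<close>
  have z: "A * B * Z = Z * (A * B) + 0\<^sub>m d d" if "A * Z = - (Z * A)" "B * Z = - (Z * B)"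
    "A \<in> carrier_mat d d" "B \<in> carrier_mat d d" "Z \<in> carrier_mat d d" for A B Z :: "complex mat"
    using that pair_commute_of_anticomm[of A d B Z] by simp
  \<comment> \<open>Each of the four operators is paired nontrivially only with its own adjoint
    inside pair \<open>k\<close>. One of the two pair products therefore commutes with it, and the
    other leaves the partner mode's operator.\<close>
  have eq: "(\<i> \<cdot>\<^sub>m G_B ks \<theta>) * annih ks k Up
      = annih ks k Up * (\<i> \<cdot>\<^sub>m G_B ks \<theta>) + of_real (\<theta> k) \<cdot>\<^sub>m (- creat ks (- k) Down - 0\<^sub>m d d)"
    "(\<i> \<cdot>\<^sub>m G_B ks \<theta>) * creat ks (- k) Down
      = creat ks (- k) Down * (\<i> \<cdot>\<^sub>m G_B ks \<theta>) + of_real (\<theta> k) \<cdot>\<^sub>m (0\<^sub>m d d - - annih ks k Up)"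
    "(\<i> \<cdot>\<^sub>m G_B ks \<theta>) * annih ks (- k) Down
      = annih ks (- k) Down * (\<i> \<cdot>\<^sub>m G_B ks \<theta>) + of_real (\<theta> k) \<cdot>\<^sub>m (creat ks k Up - 0\<^sub>m d d)"
    "(\<i> \<cdot>\<^sub>m G_B ks \<theta>) * creat ks k Up
      = creat ks k Up * (\<i> \<cdot>\<^sub>m G_B ks \<theta>) + of_real (\<theta> k) \<cdot>\<^sub>m (0\<^sub>m d d - annih ks (- k) Down)"
    subgoal by (rule G_B_commutator[OF k]; (rule other | rule z pair_commutator_of_car_left; (rule car)?)?; simp add: k nk)
    subgoal by (rule G_B_commutator[OF k]; (rule other | rule z pair_commutator_of_car_left; (rule car)?)?; simp add: k nk)
    subgoal by (rule G_B_commutator[OF k]; (rule other | rule z pair_commutator_of_car_right; (rule car)?)?; simp add: k nk)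
    subgoal by (rule G_B_commutator[OF k]; (rule other | rule z pair_commutator_of_car_right; (rule car)?)?; simp add: k nk)
    done
  have conv: "M + of_real t \<cdot>\<^sub>m (- Y - 0\<^sub>m d d) = M - of_real t \<cdot>\<^sub>m Y"
    "M + of_real t \<cdot>\<^sub>m (0\<^sub>m d d - - Y) = M + of_real t \<cdot>\<^sub>m Y"
    "M + of_real t \<cdot>\<^sub>m (Y - 0\<^sub>m d d) = M - of_real (- t) \<cdot>\<^sub>m Y"
    "M + of_real t \<cdot>\<^sub>m (0\<^sub>m d d - Y) = M + of_real (- t) \<cdot>\<^sub>m Y"
    if "M \<in> carrier_mat d d" "Y \<in> carrier_mat d d" for M Y :: "complex mat" and t :: real
    using that by (auto intro!: eq_matI)
  note M = mult_carrier_mat[OF annih_carrier iG] mult_carrier_mat[OF creat_carrier iG]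
  show "qp_annih ks \<theta> k Up = of_real (cos (\<theta> k)) \<cdot>\<^sub>m annih ks k Up - of_real (sin (\<theta> k)) \<cdot>\<^sub>m creat ks (- k) Down"
    unfolding qp_annih_def mG
    by (rule mat_exp_rotation[OF iG annih_carrier creat_carrier
          trans[OF eq(1) conv(1)[OF M(1) creat_carrier]] trans[OF eq(2) conv(2)[OF M(2) annih_carrier]]])
  \<comment> \<open>Here the two commutators have the opposite signs, since the adjoint is now the
    right factor of its pair. The rotation is thus by \<open>- \<theta> k\<close>.\<close>
  have "qp_annih ks \<theta> (- k) Down
       = of_real (cos (- \<theta> k)) \<cdot>\<^sub>m annih ks (- k) Down - of_real (sin (- \<theta> k)) \<cdot>\<^sub>m creat ks k Up"
    unfolding qp_annih_def mG
    by (rule mat_exp_rotation[OF iG annih_carrier creat_carrier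
          trans[OF eq(3) conv(3)[OF M(1) creat_carrier]] trans[OF eq(4) conv(4)[OF M(2) annih_carrier]]])
  then show "qp_annih ks \<theta> (- k) Down
       = of_real (cos (\<theta> k)) \<cdot>\<^sub>m annih ks (- k) Down - of_real (- sin (\<theta> k)) \<cdot>\<^sub>m creat ks k Up"
    by simp
qed

text \<open>Each number operator alone mixes the occupation of one mode with the vacancy of its
  partner; adding both gives the coefficient cos^2 - sin^2 for both occupations and the constant 2
  sin^2. In the second operator the reversed rotation compensates the sign from reordering the pair,
  so the cross terms add up to sin 2 theta instead of cancelling.\<close>

lemma qp_number_sum:
  assumes k: "k \<in> set ks" and ij: "i < d" "j < d"
  shows "(qp_creat ks \<theta> k Up * qp_annih ks \<theta> k Up) $$ (i, j)
      + (qp_creat ks \<theta> (- k) Down * qp_annih ks \<theta> (- k) Down) $$ (i, j)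
    = of_real (cos (2 * \<theta> k)) * ((creat ks k Up * annih ks k Up) $$ (i, j)
        + (creat ks (- k) Down * annih ks (- k) Down) $$ (i, j))
      - of_real (sin (2 * \<theta> k)) * (pair_annih ks k + pair_creat ks k) $$ (i, j)
      + of_real (1 - cos (2 * \<theta> k)) * 1\<^sub>m d $$ (i, j)"
proof -
  note nk = neg[OF k]
  have one: "of_real (cos (\<theta> k)) * of_real (cos (\<theta> k)) + of_real (sin (\<theta> k)) * of_real (sin (\<theta> k)) = (1 :: complex)"
    unfolding of_real_mult[symmetric] of_real_add[symmetric] by simp
  note dims = carrier_matD[OF annih_carrier] carrier_matD[OF creat_carrier]
  \<comment> \<open>The products appearing in the expansion are brought to number operators and to
    the fixed order of \<open>pair_annih\<close> and \<open>pair_creat\<close>.\<close>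
  have swap: "(annih ks k Up * creat ks k Up) $$ (i, j) = 1\<^sub>m d $$ (i, j) - (creat ks k Up * annih ks k Up) $$ (i, j)"
    "(annih ks (- k) Down * creat ks (- k) Down) $$ (i, j)
      = 1\<^sub>m d $$ (i, j) - (creat ks (- k) Down * annih ks (- k) Down) $$ (i, j)"
    "(creat ks (- k) Down * creat ks k Up) $$ (i, j) = - (pair_creat ks k $$ (i, j))"
    "(annih ks k Up * annih ks (- k) Down) $$ (i, j) = - (pair_annih ks k $$ (i, j))"
    using ij k nk
    by (simp_all add: annih_creat_same[OF ks] creat_creat[OF ks nk k] annih_annih[OF ks k nk] dims del: index_mult_mat(1))
  have trig: "cos (2 * \<theta> k) = (cos (\<theta> k))\<^sup>2 - (sin (\<theta> k))\<^sup>2" "sin (2 * \<theta> k) = 2 * sin (\<theta> k) * cos (\<theta> k)"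
    "1 - cos (2 * \<theta> k) = 2 * (sin (\<theta> k))\<^sup>2"
    using sin_cos_squared_add[of "\<theta> k"] by (simp_all add: cos_double sin_double cos_squared_eq[of "\<theta> k"])
  show ?thesis
    unfolding qp_annih_eq[OF k] mat_adjoint_diff_smult[OF annih_carrier creat_carrier]
      creat_eq_adjoint_annih[symmetric] annih_eq_adjoint_creat[symmetric]
      index_mult_diff_smult[OF creat_carrier annih_carrier annih_carrier creat_carrier ij] swap trig
    using ij one
    by (simp add: dims algebra_simps power2_eq_square del: index_mult_mat(1))
qed

end

end

section \<open>Summation over momenta and diagonalisation of the Hamiltonian\<close>

lemma uminus_mem_momenta: "k \<in> momenta L K \<Longrightarrow> - k \<in> momenta L K"
proof -
  assume "k \<in> momenta L K"
  then obtain n1 n2 n3 :: int where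
    k: "k = (2 * pi / L) *\<^sub>R vector [of_int n1, of_int n2, of_int n3]"
    and K: "2 * pi / L * sqrt ((of_int n1)\<^sup>2 + (of_int n2)\<^sup>2 + (of_int n3)\<^sup>2) \<le> K"
    unfolding momenta_def by blast
  have "- k = (2 * pi / L) *\<^sub>R vector [of_int (- n1), of_int (- n2), of_int (- n3)]"
    by (simp add: k Finite_Cartesian_Product.vec_eq_iff forall_3)
  moreover have "2 * pi / L * sqrt ((of_int (- n1))\<^sup>2 + (of_int (- n2))\<^sup>2 + (of_int (- n3))\<^sup>2) \<le> K"
    using K by simp
  ultimately show ?thesis unfolding momenta_def by blast
qed

text \<open>Only the spin-down half is reindexed by negation. The sum over modes becomes a sum over
  the pairs that the rotation mixes.\<close>

lemma sum_spin_pairs: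
  fixes f :: "real^3 \<Rightarrow> spin \<Rightarrow> 'a :: comm_monoid_add"
  assumes "\<And>k. k \<in> S \<Longrightarrow> - k \<in> S"
  shows "(\<Sum>k\<in>S. \<Sum>\<sigma>\<in>{Up, Down}. f k \<sigma>) = (\<Sum>k\<in>S. f k Up + f (- k) Down)"
proof -
  have "(\<Sum>k\<in>S. f k Down) = (\<Sum>k\<in>S. f (- k) Down)"
    using assms by (intro sum.reindex_bij_witness[of _ uminus uminus]) auto
  then show ?thesis by (simp add: sum.distrib)
qed

lemma index_finsum_spin_mat:
  fixes f :: "real^3 \<Rightarrow> spin \<Rightarrow> complex mat"
  assumes S: "finite S" "\<And>k. k \<in> S \<Longrightarrow> - k \<in> S" and f: "\<And>k \<sigma>. f k \<sigma> \<in> carrier_mat n n" and ij: "i < n" "j < n"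
  shows "(\<Oplus>\<^bsub>module_mat TYPE(complex) n n\<^esub>k\<in>S. \<Oplus>\<^bsub>module_mat TYPE(complex) n n\<^esub>\<sigma>\<in>{Up, Down}. f k \<sigma>) $$ (i, j)
    = (\<Sum>k\<in>S. f k Up $$ (i, j) + f (- k) Down $$ (i, j))"
proof -
  have "(\<Oplus>\<^bsub>module_mat TYPE(complex) n n\<^esub>k\<in>S. \<Oplus>\<^bsub>module_mat TYPE(complex) n n\<^esub>\<sigma>\<in>{Up, Down}. f k \<sigma>) $$ (i, j)
    = (\<Sum>k\<in>S. \<Sum>\<sigma>\<in>{Up, Down}. f k \<sigma> $$ (i, j))"
    using f by (subst index_finsum_mat[OF S(1) finsum_mat_carrier ij])
      (auto simp: index_finsum_mat[OF _ _ ij] intro!: sum.cong simp del: sum.insert)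
  then show ?thesis by (simp only: sum_spin_pairs[of S "\<lambda>k \<sigma>. f k \<sigma> $$ (i, j)", OF S(2)])
qed

text \<open>Shape of the final comparison: \<open>a\<close> and \<open>b\<close> are the scalar
  terms of the two sides, and \<open>e\<close> is the sum of the energy differences
  \<open>?E k - \<xi> k\<close>. The expectation values occur equally in \<open>a\<close> and
  \<open>b\<close> and cancel in \<open>a - e = b\<close>, so only operator entries remain to be
  compared.\<close>

lemma mat_eq_scalar_shift:
  fixes A B C :: "'a :: comm_ring_1 mat"
  assumes "A \<in> carrier_mat n n" "B \<in> carrier_mat n n" "C \<in> carrier_mat n n" and "b = a - e"
    and "\<And>i j. i < n \<Longrightarrow> j < n \<Longrightarrow> C $$ (i, j) = A $$ (i, j) - B $$ (i, j) + e * 1\<^sub>m n $$ (i, j)"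
  shows "A - B + a \<cdot>\<^sub>m 1\<^sub>m n = C + b \<cdot>\<^sub>m 1\<^sub>m n"
  using assms by (intro eq_matI) (auto simp: algebra_simps)

theorem proposition6p8:
  fixes L Kmax m \<mu> hbar :: real
    and ks :: "(real^3) list"
    and U :: "real^3 \<Rightarrow> real^3 \<Rightarrow> real"
    and \<xi> \<Delta> \<theta> :: "real^3 \<Rightarrow> real"
  assumes "L > 0" "Kmax > 0" "m > 0" "\<mu> > 0" "hbar > 0"
    and "distinct ks" "set ks = momenta L Kmax"
    and "\<xi> = band_energy hbar m \<mu>"
    and "\<And>k k'. k \<in> momenta L Kmax \<Longrightarrow> k' \<in> momenta L Kmax \<Longrightarrow> U k k' \<le> 0"
    and "\<And>k k'. k \<in> momenta L Kmax \<Longrightarrow> k' \<in> momenta L Kmax \<Longrightarrow> U k' k = U k k'"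
    and "\<And>k k'. k \<in> momenta L Kmax \<Longrightarrow> k' \<in> momenta L Kmax \<Longrightarrow> U (- k) (- k') = U k k'"
    and "\<And>k. k \<in> momenta L Kmax \<Longrightarrow> U k k = 0"
    and "\<And>k. k \<in> momenta L Kmax \<Longrightarrow> \<Delta> k \<ge> 0"
    and "\<And>k. k \<in> momenta L Kmax \<Longrightarrow> \<Delta> (- k) = \<Delta> k"
    and "\<And>k. k \<in> momenta L Kmax \<Longrightarrow> qp_energy \<xi> \<Delta> k > 0"
    and "gap_equation (momenta L Kmax) \<xi> U \<Delta>"
    and "\<And>k. k \<in> momenta L Kmax \<Longrightarrow> 0 \<le> \<theta> k \<and> \<theta> k \<le> pi / 2"
    and "\<And>k. k \<in> momenta L Kmax \<Longrightarrow> sin (2 * \<theta> k) = \<Delta> k / qp_energy \<xi> \<Delta> k"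
    and "\<And>k. k \<in> momenta L Kmax \<Longrightarrow> cos (2 * \<theta> k) = \<xi> k / qp_energy \<xi> \<Delta> k"
  shows "H_M ks \<xi> U \<Delta> \<theta> =
      (\<Oplus>\<^bsub>Op ks\<^esub>k\<in>set ks. \<Oplus>\<^bsub>Op ks\<^esub>\<sigma>\<in>{Up, Down}.
         of_real (sqrt ((\<xi> k)\<^sup>2 + (\<Delta> k)\<^sup>2)) \<cdot>\<^sub>m (qp_creat ks \<theta> k \<sigma> * qp_annih ks \<theta> k \<sigma>))
      + (\<Sum>k\<in>set ks. of_real (\<xi> k - sqrt ((\<xi> k)\<^sup>2 + (\<Delta> k)\<^sup>2))
           + of_real (\<Delta> k) * ip (Psi ks \<xi> U \<Delta> \<theta>) (pair_annih ks k *\<^sub>v Psi ks \<xi> U \<Delta> \<theta>))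
          \<cdot>\<^sub>m 1\<^sub>m (fock_dim ks)"
proof -
  let ?d = "fock_dim ks" and ?E = "\<lambda>k. sqrt ((\<xi> k)\<^sup>2 + (\<Delta> k)\<^sup>2)"
  let ?ip = "\<lambda>k. ip (Psi ks \<xi> U \<Delta> \<theta>) (pair_annih ks k *\<^sub>v Psi ks \<xi> U \<Delta> \<theta>)"
  let ?n = "\<lambda>k \<sigma>. creat ks k \<sigma> * annih ks k \<sigma>" and ?m = "\<lambda>k \<sigma>. qp_creat ks \<theta> k \<sigma> * qp_annih ks \<theta> k \<sigma>"
  let ?P = "\<lambda>k. pair_annih ks k + pair_creat ks k"
  let ?H0 = "\<Oplus>\<^bsub>Op ks\<^esub>k\<in>set ks. \<Oplus>\<^bsub>Op ks\<^esub>\<sigma>\<in>{Up, Down}. of_real (\<xi> k) \<cdot>\<^sub>m ?n k \<sigma>"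
  let ?H1 = "\<Oplus>\<^bsub>Op ks\<^esub>k\<in>set ks. of_real (\<Delta> k) \<cdot>\<^sub>m ?P k"
  let ?H2 = "\<Oplus>\<^bsub>Op ks\<^esub>k\<in>set ks. \<Oplus>\<^bsub>Op ks\<^esub>\<sigma>\<in>{Up, Down}. of_real (?E k) \<cdot>\<^sub>m ?m k \<sigma>"
  note ks = assms(6,7)
  have neg: "- k \<in> set ks" if "k \<in> set ks" for k
    using that uminus_mem_momenta by (simp add: ks(2))
  \<comment> \<open>After the spin-down sum is reindexed its coefficients sit at \<open>- k\<close>;
    evenness gives both members of a pair the same \<open>\<xi>\<close>, \<open>\<Delta>\<close> and
    energy.\<close>
  have even: "\<xi> (- k) = \<xi> k" "k \<in> set ks \<Longrightarrow> \<Delta> (- k) = \<Delta> k" for k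
    using assms(14)[of k] ks(2) by (auto simp: assms(8) band_energy_def)
  have m_car: "?m k \<sigma> \<in> carrier_mat ?d ?d" for k \<sigma>
    by (intro mult_carrier_mat[of _ _ ?d] mat_adjoint_carrier qp_annih_carrier)
  have n_car: "?n k \<sigma> \<in> carrier_mat ?d ?d" for k \<sigma>
    by (rule mult_carrier_mat[OF creat_carrier annih_carrier])
  have P_car: "?P k \<in> carrier_mat ?d ?d" for k
    by (rule add_carrier_mat[OF pair_carrier(2)])
  have H_car: "?H0 \<in> carrier_mat ?d ?d" "?H1 \<in> carrier_mat ?d ?d" "?H2 \<in> carrier_mat ?d ?d"
    by (intro finsum_mat_carrier smult_carrier_mat m_car n_car P_car; simp)+
  \<comment> \<open>This is \<open>qp_number_sum\<close> multiplied by the energy: positivity of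
    \<open>?E k\<close> clears the denominators in the equations for the double angle, so the
    coefficients become \<open>\<xi> k\<close>, \<open>\<Delta> k\<close> and
    \<open>?E k - \<xi> k\<close>.\<close>
  have key: "of_real (?E k) * (?m k Up $$ (i, j) + ?m (- k) Down $$ (i, j))
      = of_real (\<xi> k) * (?n k Up $$ (i, j) + ?n (- k) Down $$ (i, j))
        - of_real (\<Delta> k) * ?P k $$ (i, j) + of_real (?E k - \<xi> k) * 1\<^sub>m ?d $$ (i, j)"
    if k: "k \<in> set ks" and ij: "i < ?d" "j < ?d" for k i j
  proof -
    have E: "?E k > 0" and "sin (2 * \<theta> k) = \<Delta> k / ?E k" "cos (2 * \<theta> k) = \<xi> k / ?E k"
      using assms(15,18,19)[of k] k ks(2) by (simp_all add: qp_energy_def)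
    then have "?E k * cos (2 * \<theta> k) = \<xi> k" "?E k * sin (2 * \<theta> k) = \<Delta> k" by simp_all
    then have "of_real (?E k) * of_real (cos (2 * \<theta> k)) = (of_real (\<xi> k) :: complex)"
      "of_real (?E k) * of_real (sin (2 * \<theta> k)) = (of_real (\<Delta> k) :: complex)"
      "of_real (?E k) * of_real (1 - cos (2 * \<theta> k)) = (of_real (?E k - \<xi> k) :: complex)"
      unfolding of_real_mult[symmetric] by (simp_all add: right_diff_distrib)
    then show ?thesis
      by (simp only: qp_number_sum[OF ks(1) neg k ij] distrib_left right_diff_distrib mult.assoc[symmetric])
  qed
  show ?thesis unfolding H_M_def
  proof (rule mat_eq_scalar_shift[OF H_car])
    show "(\<Sum>k\<in>set ks. of_real (\<xi> k - ?E k) + of_real (\<Delta> k) * ?ip k)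
        = (\<Sum>k\<in>set ks. of_real (\<Delta> k) * ?ip k) - (\<Sum>k\<in>set ks. of_real (?E k - \<xi> k))"
      unfolding sum_subtractf[symmetric] by (intro sum.cong) (auto simp: algebra_simps)
    fix i j assume ij: "i < ?d" "j < ?d"
    have H0: "?H0 $$ (i, j) = (\<Sum>k\<in>set ks. of_real (\<xi> k) * (?n k Up $$ (i, j) + ?n (- k) Down $$ (i, j)))"
    proof -
      have "?H0 $$ (i, j)
          = (\<Sum>k\<in>set ks. (of_real (\<xi> k) \<cdot>\<^sub>m ?n k Up) $$ (i, j) + (of_real (\<xi> (- k)) \<cdot>\<^sub>m ?n (- k) Down) $$ (i, j))"
        by (intro index_finsum_spin_mat finite_set neg smult_carrier_mat n_car ij)
      also have "\<dots> = (\<Sum>k\<in>set ks. of_real (\<xi> k) * (?n k Up $$ (i, j) + ?n (- k) Down $$ (i, j)))"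
        by (intro sum.cong refl) (simp only: even index_smult_mat carrier_matD[OF n_car] ij distrib_left)
      finally show ?thesis .
    qed
    have H2: "?H2 $$ (i, j) = (\<Sum>k\<in>set ks. of_real (?E k) * (?m k Up $$ (i, j) + ?m (- k) Down $$ (i, j)))"
    proof -
      have "?H2 $$ (i, j)
          = (\<Sum>k\<in>set ks. (of_real (?E k) \<cdot>\<^sub>m ?m k Up) $$ (i, j) + (of_real (?E (- k)) \<cdot>\<^sub>m ?m (- k) Down) $$ (i, j))"
        by (intro index_finsum_spin_mat finite_set neg smult_carrier_mat m_car ij)
      also have "\<dots> = (\<Sum>k\<in>set ks. of_real (?E k) * (?m k Up $$ (i, j) + ?m (- k) Down $$ (i, j)))"
        by (intro sum.cong refl) (simp only: even index_smult_mat carrier_matD[OF m_car] ij distrib_left)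
      finally show ?thesis .
    qed
    have H1: "?H1 $$ (i, j) = (\<Sum>k\<in>set ks. of_real (\<Delta> k) * ?P k $$ (i, j))"
    proof -
      have "?H1 $$ (i, j) = (\<Sum>k\<in>set ks. (of_real (\<Delta> k) \<cdot>\<^sub>m ?P k) $$ (i, j))"
        by (intro index_finsum_mat finite_set smult_carrier_mat P_car ij)
      also have "\<dots> = (\<Sum>k\<in>set ks. of_real (\<Delta> k) * ?P k $$ (i, j))"
        by (intro sum.cong refl) (simp only: index_smult_mat carrier_matD[OF P_car] ij)
      finally show ?thesis .
    qed
    show "?H2 $$ (i, j) = ?H0 $$ (i, j) - ?H1 $$ (i, j) + (\<Sum>k\<in>set ks. of_real (?E k - \<xi> k)) * 1\<^sub>m ?d $$ (i, j)"
      unfolding H0 H1 H2 sum_distrib_right sum_subtractf[symmetric] sum.distrib[symmetric]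
      by (intro sum.cong refl key ij)
  qed
qed

end
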